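(* For integers $1\le k\le m$, the sample complexity of $k$-local tomography of $m$-qubit quantum states with a streaming algorithm is $$O\!\left(\frac{108^k\left(\log\binom{m}{k}+k\log 6\right)}{\epsilon^2}\right),$$ with an absolute implied constant. For constant $k$, it is $\Theta\!\left(\frac{\log m}{\epsilon^2}\right)$ (implied constants depending only on $k$).
   Context: An $m$-qubit state is a density operator on $(\mathbb{C}^2)^{\otimes m}$. $\|A\|_1=\operatorname{Tr}\sqrt{A^\dagger A}$. $\log$ is the binary logarithm. A streaming algorithm (local measurement) using $n$ copies of $\rho$ measures each qubit of each copy separately with a one-qubit POVM, all these POVMs being fixed in advance (non-adaptive), so that the overall POVM on $\rho^{\otimes n}$ is a tensor product of one-qubit POVMs; the outcomes are then processed classically. $k$-local tomography with parameter $\epsilon\in(0,1]$: given copies of an arbitrary unknown $m$-qubit state $\rho$, output estimates $\hat\rho_S$ for all $S\subseteq[m]$ with $|S|=k$ such that, with probability at least $\tfrac23$, $\|\hat\rho_S-\rho_S\|_1\le\epsilon$ simultaneously for all such $S$, where $\rho_S$ is the reduced density matrix of $\rho$ on the qubits in $S$. The sample complexity is the least number of copies for which a streaming algorithm achieves this for every $\rho$. As usual, the $\Theta$ statement is asymptotic: the bounds are for all sufficiently large $m$ and all sufficiently small $\epsilon$ (thresholds depending only on $k$). *)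

theory Defs
  imports
    "HOL-Library.Extended_Real"
    "HOL-Library.FuncSet"
    "HOL-Probability.Probability_Mass_Function"
    "Jordan_Normal_Form.Schur_Decomposition"
begin

text \<open>
  Operators on \<open>m\<close> qubits are complex matrices of dimension \<open>2 ^ m\<close>, written in the
  computational basis. Qubits are numbered from \<open>0\<close>, and qubit \<open>0\<close> is the most significant
  bit of a basis index, so that the leftmost factor of \<open>kron_list\<close> below acts on qubit \<open>0\<close>.
\<close>

subsection \<open>Positive semidefinite matrices and the trace norm\<close>

definition mat_trace :: "complex mat \<Rightarrow> complex" where
  "mat_trace A = (\<Sum>i<dim_row A. A $$ (i, i))"

text \<open>
  In the order on \<^typ>\<open>complex\<close>, \<open>0 \<le> z\<close> says that \<open>z\<close> is real and nonnegative, so this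
  condition includes that \<open>A\<close> is Hermitian.
\<close>

definition psd_mat :: "nat \<Rightarrow> complex mat \<Rightarrow> bool" where
  "psd_mat n A \<longleftrightarrow> A \<in> carrier_mat n n \<and> (\<forall>v\<in>carrier_vec n. 0 \<le> (A *\<^sub>v v) \<bullet>c v)"

definition psd_sqrt :: "complex mat \<Rightarrow> complex mat" where
  "psd_sqrt A = (THE B. psd_mat (dim_row A) B \<and> B * B = A)"

definition trace_norm :: "complex mat \<Rightarrow> real" where
  "trace_norm A = Re (mat_trace (psd_sqrt (mat_adjoint A * A)))"

subsection \<open>States, tensor products and reduced states\<close>

definition density_operator :: "nat \<Rightarrow> complex mat \<Rightarrow> bool" where
  "density_operator m \<rho> \<longleftrightarrow> psd_mat (2 ^ m) \<rho> \<and> mat_trace \<rho> = 1"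

definition kron :: "complex mat \<Rightarrow> complex mat \<Rightarrow> complex mat" where
  "kron A B = mat (dim_row A * dim_row B) (dim_col A * dim_col B)
     (\<lambda>(i, j). A $$ (i div dim_row B, j div dim_col B) * B $$ (i mod dim_row B, j mod dim_col B))"

definition kron_list :: "complex mat list \<Rightarrow> complex mat" where
  "kron_list As = foldr kron As (1\<^sub>m 1)"

text \<open>The value of qubit \<open>i\<close> in the basis state with index \<open>c\<close> of an \<open>m\<close>-qubit system.\<close>

definition qubit :: "nat \<Rightarrow> nat \<Rightarrow> nat \<Rightarrow> nat" where
  "qubit m i c = c div 2 ^ (m - 1 - i) mod 2"

text \<open>
  The \<open>|S|\<close>-qubit basis index \<open>a\<close> is the restriction to \<open>S\<close> of the \<open>m\<close>-qubit basis index \<open>c\<close>;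
  the qubits in \<open>S\<close> keep their order.
\<close>

definition restricts_to :: "nat \<Rightarrow> nat set \<Rightarrow> nat \<Rightarrow> nat \<Rightarrow> bool" where
  "restricts_to m S c a \<longleftrightarrow> (\<forall>i\<in>S. qubit m i c = qubit (card S) (card {j \<in> S. j < i}) a)"

text \<open>
  Partial trace over the qubits outside \<open>S\<close>: \<open>\<rho>\<^sub>S(a, b)\<close> is the sum of \<open>\<rho>(c, d)\<close> over the indices
  \<open>c\<close>, \<open>d\<close> that extend \<open>a\<close>, \<open>b\<close> by the same values on the qubits outside \<open>S\<close>.
\<close>

definition reduced_state :: "nat \<Rightarrow> nat set \<Rightarrow> complex mat \<Rightarrow> complex mat" where
  "reduced_state m S \<rho> = mat (2 ^ card S) (2 ^ card S)
     (\<lambda>(a, b). \<Sum>(c, d) \<in> {(c, d). c < 2 ^ m \<and> d < 2 ^ m \<and>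
          restricts_to m S c a \<and> restricts_to m S d b \<and>
          (\<forall>i<m. i \<notin> S \<longrightarrow> qubit m i c = qubit m i d)}. \<rho> $$ (c, d))"

subsection \<open>Streaming measurements\<close>

text \<open>A one-qubit POVM with finitely many outcomes is the list of its effects.\<close>

definition qubit_povm :: "complex mat list \<Rightarrow> bool" where
  "qubit_povm Es \<longleftrightarrow> (\<forall>E\<in>set Es. psd_mat 2 E) \<and> foldr (+) Es (0\<^sub>m 2 2) = 1\<^sub>m 2"

text \<open>\<open>M t i\<close> is the POVM applied to qubit \<open>i\<close> of copy \<open>t\<close>.\<close>

definition streaming_measurement :: "nat \<Rightarrow> nat \<Rightarrow> (nat \<Rightarrow> nat \<Rightarrow> complex mat list) \<Rightarrow> bool" where
  "streaming_measurement n m M \<longleftrightarrow> (\<forall>t<n. \<forall>i<m. qubit_povm (M t i))"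

definition outcomes :: "nat \<Rightarrow> nat \<Rightarrow> (nat \<Rightarrow> nat \<Rightarrow> complex mat list) \<Rightarrow> (nat \<times> nat \<Rightarrow> nat) set" where
  "outcomes n m M = (\<Pi>\<^sub>E (t, i) \<in> {..<n} \<times> {..<m}. {..<length (M t i)})"

text \<open>\<open>List.product\<close> lists the pairs \<open>(t, i)\<close> copy by copy, as the factors of \<open>\<rho>\<^sup>\<otimes>\<^sup>n\<close> require.\<close>

definition outcome_effect ::
    "nat \<Rightarrow> nat \<Rightarrow> (nat \<Rightarrow> nat \<Rightarrow> complex mat list) \<Rightarrow> (nat \<times> nat \<Rightarrow> nat) \<Rightarrow> complex mat" where
  "outcome_effect n m M x =
     kron_list (map (\<lambda>(t, i). M t i ! x (t, i)) (List.product [0..<n] [0..<m]))"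

definition outcome_prob ::
    "nat \<Rightarrow> nat \<Rightarrow> (nat \<Rightarrow> nat \<Rightarrow> complex mat list) \<Rightarrow> complex mat \<Rightarrow> (nat \<times> nat \<Rightarrow> nat) \<Rightarrow> real" where
  "outcome_prob n m M \<rho> x = Re (mat_trace (outcome_effect n m M x * kron_list (replicate n \<rho>)))"

subsection \<open>Local tomography\<close>

definition accurate ::
    "nat \<Rightarrow> nat \<Rightarrow> real \<Rightarrow> complex mat \<Rightarrow> (nat set \<Rightarrow> complex mat) \<Rightarrow> bool" where
  "accurate k m \<epsilon> \<rho> est \<longleftrightarrow>
     (\<forall>S. S \<subseteq> {..<m} \<and> card S = k \<longrightarrow>
        est S \<in> carrier_mat (2 ^ k) (2 ^ k) \<and> trace_norm (est S - reduced_state m S \<rho>) \<le> \<epsilon>)"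

text \<open>
  The classical processing \<open>D\<close> may be randomized: an outcome \<open>x\<close> yields a random family
  of estimates with distribution \<open>D x\<close>.
\<close>

definition success_prob ::
    "nat \<Rightarrow> nat \<Rightarrow> real \<Rightarrow> nat \<Rightarrow> (nat \<Rightarrow> nat \<Rightarrow> complex mat list) \<Rightarrow>
     ((nat \<times> nat \<Rightarrow> nat) \<Rightarrow> (nat set \<Rightarrow> complex mat) pmf) \<Rightarrow> complex mat \<Rightarrow> real" where
  "success_prob k m \<epsilon> n M D \<rho> =
     (\<Sum>x\<in>outcomes n m M.
        outcome_prob n m M \<rho> x * measure_pmf.prob (D x) {est. accurate k m \<epsilon> \<rho> est})"

definition streaming_tomography_possible :: "nat \<Rightarrow> nat \<Rightarrow> real \<Rightarrow> nat \<Rightarrow> bool" where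
  "streaming_tomography_possible k m \<epsilon> n \<longleftrightarrow>
     (\<exists>M D. streaming_measurement n m M \<and>
        (\<forall>\<rho>. density_operator m \<rho> \<longrightarrow> success_prob k m \<epsilon> n M D \<rho> \<ge> 2 / 3))"

text \<open>The least sufficient number of copies, which is \<open>\<infinity>\<close> if no number suffices.\<close>

definition sample_complexity :: "nat \<Rightarrow> nat \<Rightarrow> real \<Rightarrow> enat" where
  "sample_complexity k m \<epsilon> = Inf (enat ` {n. streaming_tomography_possible k m \<epsilon> n})"

end

(*
  Upper bound: every qubit of every copy is measured in a uniformly random Pauli basis. The dual frame
  of this one-qubit measurement turns the outcomes on the qubits of S into an unbiased estimator of
  each entry of the reduced state on S, bounded by 2^k. A Chernoff bound for the average over the
  copies and a union bound over S and the entries control the Frobenius norm of the error, hence its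
  trace norm; this needs only 32^k in place of 108^k.

  Lower bound: take products of the qubit states (1 + 2 eps Z) / 2 and (1 - 2 eps Z) / 2. Accurate
  k-local tomography identifies all m signs. On these states a streaming measurement gives independent
  outcomes for the qubits, so the probability of guessing all signs is a product over the qubits, and
  each factor falls short of 1 by at least (1 - 4 eps^2)^n / 4. For the product to stay
  above 2/3 this deficit must be O(1/m).
*)

theory Submission
  imports Defs
begin

subsection \<open>Adjoints and positive semidefinite matrices\<close>

text \<open>\<open>psd_sqrt\<close> is a definite description, so \<open>trace_norm\<close> says
  nothing until positive square roots are known to exist and to be unique; hence the spectral
  theorem. Afterwards the trace norm enters through two estimates only: from above by the Frobenius
  norm, and from below by functionals with diagonal coefficients of modulus at most 1, which in the
  lower bound read off the expectation of Z on one qubit. The base 32 is 8 * 4: passing from entries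
  to the trace norm costs \<open>sqrt (2 * 8 ^ k)\<close>, and the range \<open>2 ^ k\<close> of the
  estimator enters the Chernoff exponent squared. The bias is 2 \<epsilon> because states that
  differ in a sign then have Z-expectations 4 \<epsilon> apart, while an accurate estimate
  determines them up to \<epsilon>. Learning one sign with constant error would force only 1 /
  \<epsilon>^2 copies; the factor log m appears because all m signs must be right at once and every
  qubit has its own independent data. All probabilities are finite sums over outcome functions, the
  form in which \<open>success_prob\<close> is given.\<close>

lemma adjoint_carrier [simp]: "A \<in> carrier_mat n k \<Longrightarrow> mat_adjoint A \<in> carrier_mat k n"
  unfolding mat_adjoint_def by (auto simp: mat_of_rows_def)

lemma dim_adjoint [simp]:
  "dim_row (mat_adjoint A) = dim_col A" "dim_col (mat_adjoint A) = dim_row A"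
  unfolding mat_adjoint_def by auto

lemma index_adjoint [simp]:
  fixes A :: "complex mat"
  shows "i < dim_col A \<Longrightarrow> j < dim_row A \<Longrightarrow> mat_adjoint A $$ (i, j) = cnj (A $$ (j, i))"
  unfolding mat_adjoint_def by (simp add: mat_of_rows_def cols_def conjugate_complex_def)

lemma adjoint_adjoint [simp]: "mat_adjoint (mat_adjoint A) = (A :: complex mat)"
  by (rule eq_matI) auto

lemma index_mult_sum:
  fixes A B :: "'a :: semiring_0 mat"
  assumes "A \<in> carrier_mat n k" "B \<in> carrier_mat k l" "i < n" "j < l"
  shows "(A * B) $$ (i, j) = (\<Sum>r<k. A $$ (i, r) * B $$ (r, j))"
  using assms by (simp add: scalar_prod_def atLeast0LessThan)

lemma adjoint_mult:
  assumes A: "A \<in> carrier_mat n k" and B: "(B :: complex mat) \<in> carrier_mat k l"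
  shows "mat_adjoint (A * B) = mat_adjoint B * mat_adjoint A"
proof (rule eq_matI)
  fix i j assume "i < dim_row (mat_adjoint B * mat_adjoint A)" "j < dim_col (mat_adjoint B * mat_adjoint A)"
  then have ij: "i < l" "j < n" using A B by auto
  then have "mat_adjoint (A * B) $$ (i, j) = cnj ((A * B) $$ (j, i))"
    using A B by (subst index_adjoint) auto
  also have "\<dots> = (mat_adjoint B * mat_adjoint A) $$ (i, j)"
    using A B ij index_mult_sum[OF A B ij(2,1)] index_mult_sum[of "mat_adjoint B" l k "mat_adjoint A" n i j]
    by (auto simp: mult.commute intro!: sum.cong)
  finally show "mat_adjoint (A * B) $$ (i, j) = (mat_adjoint B * mat_adjoint A) $$ (i, j)" .
qed (use A B in auto)

lemma cscalar_prod_sum: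
  assumes "v \<in> carrier_vec n" "w \<in> carrier_vec n"
  shows "v \<bullet>c w = (\<Sum>i<n. v $ i * cnj (w $ i))"
  using assms by (simp add: scalar_prod_def atLeast0LessThan conjugate_complex_def)

lemma quadratic_form_sum:
  assumes "A \<in> carrier_mat n n" "v \<in> carrier_vec n"
  shows "(A *\<^sub>v v) \<bullet>c v = (\<Sum>i<n. \<Sum>j<n. A $$ (i, j) * v $ j * cnj (v $ i))"
proof -
  have "(A *\<^sub>v v) \<bullet>c v = (\<Sum>i<n. (A *\<^sub>v v) $ i * cnj (v $ i))"
    using assms by (intro cscalar_prod_sum) auto
  also have "\<dots> = (\<Sum>i<n. \<Sum>j<n. A $$ (i, j) * v $ j * cnj (v $ i))"
    using assms by (intro sum.cong) (auto simp: scalar_prod_def atLeast0LessThan sum_distrib_right)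
  finally show ?thesis .
qed

lemma adjoint_cscalar_prod:
  fixes U :: "complex mat"
  assumes U: "U \<in> carrier_mat n k" and v: "v \<in> carrier_vec k" and w: "w \<in> carrier_vec n"
  shows "(mat_adjoint U *\<^sub>v w) \<bullet>c v = w \<bullet>c (U *\<^sub>v v)"
proof -
  have "(mat_adjoint U *\<^sub>v w) \<bullet>c v = (\<Sum>i<k. (\<Sum>j<n. cnj (U $$ (j, i)) * w $ j) * cnj (v $ i))"
    using U v w mult_mat_vec_carrier[OF adjoint_carrier[OF U] w] by (subst cscalar_prod_sum[of _ k])
      (auto intro!: sum.cong simp: scalar_prod_def atLeast0LessThan)
  also have "\<dots> = (\<Sum>j<n. w $ j * cnj (\<Sum>i<k. U $$ (j, i) * v $ i))"
    unfolding sum_distrib_right cnj_sum sum_distrib_left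
    by (subst sum.swap) (simp add: mult_ac)
  also have "\<dots> = w \<bullet>c (U *\<^sub>v v)"
    using U v w by (subst cscalar_prod_sum[of _ n])
      (auto intro!: sum.cong simp: scalar_prod_def atLeast0LessThan)
  finally show ?thesis .
qed

text \<open><U* B U v, v> = <B (U v), U v>. With B = 1 this covers products A* A, and with unitary U
  the nonnegativity of eigenvalues.\<close>

lemma psd_mat_congruence:
  assumes B: "psd_mat n B" and U: "U \<in> carrier_mat n k"
  shows "psd_mat k (mat_adjoint U * B * U)"
proof -
  have Bc: "B \<in> carrier_mat n n" using B by (simp add: psd_mat_def)
  have "0 \<le> ((mat_adjoint U * B * U) *\<^sub>v v) \<bullet>c v" if v: "v \<in> carrier_vec k" for v
  proof -
    have "(mat_adjoint U * B * U) *\<^sub>v v = mat_adjoint U *\<^sub>v (B *\<^sub>v (U *\<^sub>v v))"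
      using assoc_mult_mat_vec[of "mat_adjoint U" k n "B * U" k v] assoc_mult_mat_vec[of B n n U k v]
        U Bc v by (simp add: assoc_mult_mat[of _ k n])
    also have "\<dots> \<bullet>c v = (B *\<^sub>v (U *\<^sub>v v)) \<bullet>c (U *\<^sub>v v)"
      using U Bc v by (intro adjoint_cscalar_prod[of _ n k]) auto
    also have "\<dots> \<ge> 0" using B U v by (auto simp: psd_mat_def)
    finally show ?thesis .
  qed
  then show ?thesis using U Bc by (auto simp: psd_mat_def)
qed

lemma psd_mat_one: "psd_mat n (1\<^sub>m n)"
  by (auto simp: psd_mat_def intro!: conjugate_square_ge_0_vec)

lemma psd_mat_adjoint_mult: "A \<in> carrier_mat n k \<Longrightarrow> psd_mat k (mat_adjoint A * A)"
  using psd_mat_congruence[OF psd_mat_one, of A n k] by simp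

lemma psd_mat_diagonal:
  assumes "\<And>i. i < n \<Longrightarrow> 0 \<le> d i"
  shows "psd_mat n (mat_diag n d)"
proof -
  have "0 \<le> (mat_diag n d *\<^sub>v v) \<bullet>c v" if v: "v \<in> carrier_vec n" for v
  proof -
    have "(mat_diag n d *\<^sub>v v) \<bullet>c v = (\<Sum>i<n. \<Sum>j<n. (if i = j then d j * v $ j * cnj (v $ i) else 0))"
      unfolding quadratic_form_sum[OF mat_diag_dim v]
      by (intro sum.cong refl) (auto simp: mat_diag_def)
    also have "\<dots> = (\<Sum>i<n. d i * (v $ i * cnj (v $ i)))"
      by (intro sum.cong) (auto simp: mult.assoc)
    also have "\<dots> \<ge> 0"
    proof (rule sum_nonneg)
      fix i assume "i \<in> {..<n}"
      moreover have "0 \<le> v $ i * cnj (v $ i)"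
        unfolding complex_mult_cnj by (simp add: less_eq_complex_def)
      ultimately show "0 \<le> d i * (v $ i * cnj (v $ i))"
        using assms by (intro mult_nonneg_nonneg[of "d i"]) auto
    qed
    finally show ?thesis .
  qed
  then show ?thesis by (auto simp: psd_mat_def mat_diag_def)
qed

lemma psd_mat_diag_nonneg:
  assumes A: "psd_mat n A" and i: "i < n"
  shows "0 \<le> A $$ (i, i)"
proof -
  have Ac: "A \<in> carrier_mat n n" using A by (simp add: psd_mat_def)
  have "0 \<le> (A *\<^sub>v unit_vec n i) \<bullet>c unit_vec n i" using A by (auto simp: psd_mat_def)
  also have "\<dots> = (\<Sum>j<n. \<Sum>l<n. if l = i then (if j = i then A $$ (j, l) else 0) else 0)"
    unfolding quadratic_form_sum[OF Ac unit_vec_carrier]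
    by (intro sum.cong refl) (use i in \<open>auto simp: unit_vec_def\<close>)
  also have "\<dots> = A $$ (i, i)" using i by (simp add: sum.delta)
  finally show ?thesis .
qed

text \<open>Polarization: the form is real at e_i + z e_j. Taking z = 1 makes the imaginary parts of
  the entries (i, j) and (j, i) opposite, z = \<i> makes their real parts equal.\<close>

lemma psd_mat_hermitian:
  assumes A: "psd_mat n A"
  shows "mat_adjoint A = A"
proof -
  have Ac: "A \<in> carrier_mat n n" using A by (simp add: psd_mat_def)
  have "A $$ (i, j) = cnj (A $$ (j, i))" if i: "i < n" and j: "j < n" for i j
  proof (cases "i = j")
    case True
    then show ?thesis using psd_mat_diag_nonneg[OF A i] by (simp add: less_eq_complex_def complex_eq_iff)
  next
    case False
    have quad: "(A *\<^sub>v (unit_vec n i + z \<cdot>\<^sub>v unit_vec n j)) \<bullet>c (unit_vec n i + z \<cdot>\<^sub>v unit_vec n j)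
       = A $$ (i, i) + z * A $$ (i, j) + cnj z * A $$ (j, i) + z * cnj z * A $$ (j, j)" for z
    proof -
      let ?v = "unit_vec n i + z \<cdot>\<^sub>v unit_vec n j"
      have v: "?v $ l = (if l = i then 1 else if l = j then z else 0)" if "l < n" for l
        using that i j False by (auto simp: unit_vec_def)
      have inner: "(\<Sum>l<n. B l * ?v $ l) = B i + B j * z" for B
      proof -
        have "(\<Sum>l<n. B l * ?v $ l) = (\<Sum>l\<in>{i, j}. B l * ?v $ l)"
          using i j v by (intro sum.mono_neutral_right) auto
        then show ?thesis using False i j v by (simp del: index_add_vec)
      qed
      have outer: "(\<Sum>l<n. B l * cnj (?v $ l)) = B i + B j * cnj z" for B
      proof -
        have "(\<Sum>l<n. B l * cnj (?v $ l)) = (\<Sum>l\<in>{i, j}. B l * cnj (?v $ l))"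
          using i j v by (intro sum.mono_neutral_right) auto
        then show ?thesis using False i j v by (simp del: index_add_vec)
      qed
      have "(A *\<^sub>v ?v) \<bullet>c ?v = (\<Sum>l<n. (\<Sum>r<n. A $$ (l, r) * ?v $ r) * cnj (?v $ l))"
        using Ac by (subst quadratic_form_sum) (auto simp: sum_distrib_right)
      then show ?thesis by (simp only: inner outer) (simp add: algebra_simps)
    qed
    have real: "Im ((A *\<^sub>v w) \<bullet>c w) = 0" if "w \<in> carrier_vec n" for w
      using A that by (auto simp: psd_mat_def less_eq_complex_def)
    have diag: "Im (A $$ (i, i)) = 0" "Im (A $$ (j, j)) = 0"
      using psd_mat_diag_nonneg[OF A] i j by (auto simp: less_eq_complex_def)
    have "Im (A $$ (i, j)) + Im (A $$ (j, i)) = 0"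
      using real[of "unit_vec n i + 1 \<cdot>\<^sub>v unit_vec n j", unfolded quad] diag by simp
    moreover have "Re (A $$ (i, j)) - Re (A $$ (j, i)) = 0"
      using real[of "unit_vec n i + \<i> \<cdot>\<^sub>v unit_vec n j", unfolded quad] diag by simp
    ultimately show ?thesis by (simp add: complex_eq_iff)
  qed
  then have "mat_adjoint A $$ (i, j) = A $$ (i, j)" if "i < n" "j < n" for i j
    using Ac that by (metis index_adjoint carrier_matD)
  then show ?thesis using Ac by (intro eq_matI) (simp_all del: index_adjoint)
qed

subsection \<open>The spectral theorem\<close>

text \<open>Gram-Schmidt applied to a basis completion of \<open>v\<close> keeps \<open>v\<close> as
  first vector and yields orthogonal vectors, which are then normalized. As \<open>v\<close> may
  have any nonzero length, the first column is only a multiple of it.\<close>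

lemma unitary_with_first_column:
  fixes v :: "complex vec"
  assumes v: "v \<in> carrier_vec n" and v0: "v \<noteq> 0\<^sub>v n"
  shows "\<exists>W c. W \<in> carrier_mat n n \<and> mat_adjoint W * W = 1\<^sub>m n \<and> col W 0 = c \<cdot>\<^sub>v v"
proof -
  interpret cof_vec_space n "TYPE(complex)" .
  define b where "b = basis_completion v"
  define ws where "ws = gram_schmidt n b"
  from basis_completion[OF v v0, folded b_def]
  have dist_b: "distinct b" and indep: "\<not> lin_dep (set b)" and b: "set b \<subseteq> carrier_vec n"
    and hdb: "hd b = v" and len_b: "length b = n" by auto
  have n: "n > 0" using v v0 by (cases n) auto
  from hdb len_b n obtain vs where bv: "b = v # vs" by (cases b) auto
  from gram_schmidt_result[OF b dist_b indep refl, folded ws_def]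
  have ws: "set ws \<subseteq> carrier_vec n" "corthogonal ws" "length ws = n" by (auto simp: len_b)
  from gram_schmidt_hd[OF v, of vs, folded bv] have hdws: "hd ws = v" unfolding ws_def .
  have wsc: "ws ! i \<in> carrier_vec n" if "i < n" for i using ws that by auto
  define r where "r i = complex_of_real (1 / sqrt (Re (ws ! i \<bullet>c ws ! i)))" for i
  define W where "W = mat n n (\<lambda>(i, j). r j * ws ! j $ i)"
  have W: "W \<in> carrier_mat n n" by (simp add: W_def)
  have "(mat_adjoint W * W) $$ (i, j) = (if i = j then 1 else 0)" if ij: "i < n" "j < n" for i j
  proof -
    have "(mat_adjoint W * W) $$ (i, j) = (\<Sum>l<n. mat_adjoint W $$ (i, l) * W $$ (l, j))"
      using W ij by (intro index_mult_sum) auto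
    also have "\<dots> = (\<Sum>l<n. cnj (r i * ws ! i $ l) * (r j * ws ! j $ l))"
      using ij by (intro sum.cong) (auto simp: W_def)
    also have "\<dots> = r i * r j * (\<Sum>l<n. ws ! j $ l * cnj (ws ! i $ l))"
      unfolding sum_distrib_left by (intro sum.cong refl) (simp add: r_def)
    also have "\<dots> = r i * r j * (ws ! j \<bullet>c ws ! i)"
      using wsc ij by (subst cscalar_prod_sum[of _ n]) auto
    also have "\<dots> = (if i = j then 1 else 0)"
    proof (cases "i = j")
      case True
      have ge: "ws ! i \<bullet>c ws ! i \<ge> 0" by (rule conjugate_square_ge_0_vec)
      have "ws ! i \<bullet>c ws ! i \<noteq> 0" using corthogonalD[OF ws(2)] ij ws(3) by auto
      with ge have *: "ws ! i \<bullet>c ws ! i = complex_of_real (Re (ws ! i \<bullet>c ws ! i))"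
        "Re (ws ! i \<bullet>c ws ! i) > 0"
        by (auto simp: less_eq_complex_def complex_eq_iff)
      have "r i * r i * (ws ! i \<bullet>c ws ! i) = complex_of_real (1 / sqrt (Re (ws ! i \<bullet>c ws ! i))
          * (1 / sqrt (Re (ws ! i \<bullet>c ws ! i))) * Re (ws ! i \<bullet>c ws ! i))"
        by (subst *(1)) (simp only: r_def of_real_mult)
      also have "\<dots> = 1" using *(2) by (simp add: field_simps)
      finally show ?thesis using True by simp
    next
      case False
      then show ?thesis using corthogonalD[OF ws(2), of j i] ij ws(3) by auto
    qed
    finally show ?thesis .
  qed
  then have "mat_adjoint W * W = 1\<^sub>m n" using W by (intro eq_matI) auto
  moreover have "col W 0 = r 0 \<cdot>\<^sub>v v"
  proof -
    have "ws ! 0 = v" using hdws ws(3) n by (cases ws) auto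
    then show ?thesis using n v by (intro eq_vecI) (auto simp: W_def)
  qed
  ultimately show ?thesis using W by blast
qed

lemma left_unitary_right:
  assumes "U \<in> carrier_mat n n" "mat_adjoint U * U = (1\<^sub>m n :: complex mat)"
  shows "U * mat_adjoint U = 1\<^sub>m n"
  using mat_mult_left_right_inverse[of "mat_adjoint U" n U] assms by auto

lemma eigenvector_exists:
  assumes A: "(A :: complex mat) \<in> carrier_mat n n" and n: "n > 0"
  shows "\<exists>v e. v \<in> carrier_vec n \<and> v \<noteq> 0\<^sub>v n \<and> A *\<^sub>v v = e \<cdot>\<^sub>v v"
proof -
  have "degree (char_poly A) = n" using degree_monic_char_poly[OF A] by simp
  then have "\<not> constant (poly (char_poly A))" using n by (simp add: constant_degree)
  then obtain e where "poly (char_poly A) e = 0"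
    using fundamental_theorem_of_algebra by blast
  then have "eigenvalue A e" using eigenvalue_root_char_poly[OF A] by simp
  then show ?thesis using A unfolding eigenvalue_def eigenvector_def by auto
qed

text \<open>Dimensions that occur only in premises are all fixed to one \<open>n\<close>, so that
  the simplifier can check the premises when it reassociates products of square matrices.\<close>

lemmas square_mat_simps =
  assoc_mult_mat[of _ n n _ n _ n] mult_carrier_mat[of _ n n _ n] adjoint_carrier[of _ n n] for n

lemma adjoint_mult_diag:
  fixes M :: "complex mat"
  assumes M: "M \<in> carrier_mat n k" and j: "j < k"
  shows "(mat_adjoint M * M) $$ (j, j) = complex_of_real (\<Sum>i<n. (cmod (M $$ (i, j)))\<^sup>2)"
proof -
  have "(mat_adjoint M * M) $$ (j, j) = (\<Sum>i<n. mat_adjoint M $$ (j, i) * M $$ (i, j))"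
    using M j by (intro index_mult_sum[of _ k n _ k]) auto
  also have "\<dots> = (\<Sum>i<n. complex_of_real ((cmod (M $$ (i, j)))\<^sup>2))"
    using M j by (intro sum.cong refl) (simp add: complex_norm_square mult.commute del: of_real_power)
  finally show ?thesis by simp
qed

lemma unitary_mult:
  assumes "U \<in> carrier_mat n n" "mat_adjoint U * U = (1\<^sub>m n :: complex mat)"
    and "V \<in> carrier_mat n n" "mat_adjoint V * V = (1\<^sub>m n :: complex mat)"
  shows "mat_adjoint (U * V) * (U * V) = 1\<^sub>m n"
proof -
  have "mat_adjoint (U * V) * (U * V) = mat_adjoint V * (mat_adjoint U * U) * V"
    using assms(1,3) by (simp add: adjoint_mult[of _ n n _ n] square_mat_simps[where n = n])
  then show ?thesis using assms by simp
qed

text \<open>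
  In an orthonormal basis starting with an eigenvector the first column, hence by symmetry the
  first row, of a Hermitian matrix vanishes off the diagonal; the remaining block is Hermitian.
\<close>

theorem hermitian_diagonalization:
  assumes A: "A \<in> carrier_mat n n" and H: "mat_adjoint A = (A :: complex mat)"
  shows "\<exists>U d. U \<in> carrier_mat n n \<and> mat_adjoint U * U = 1\<^sub>m n \<and>
    mat_adjoint U * A * U = mat_diag n (\<lambda>i. complex_of_real (d i))"
  using A H
proof (induction n arbitrary: A)
  case 0
  then show ?case
    by (intro exI[of _ "1\<^sub>m 0"] exI[of _ "\<lambda>_. 0"]) (auto intro!: eq_matI simp: mat_diag_def)
next
  case (Suc n A)
  let ?N = "Suc n"
  note A = Suc.prems(1) and H = Suc.prems(2)
  obtain v e where v: "v \<in> carrier_vec ?N" "v \<noteq> 0\<^sub>v ?N" and ev: "A *\<^sub>v v = e \<cdot>\<^sub>v v"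
    using eigenvector_exists[OF A] by auto
  obtain W c where W: "W \<in> carrier_mat ?N ?N" "mat_adjoint W * W = 1\<^sub>m ?N" and col0: "col W 0 = c \<cdot>\<^sub>v v"
    using unitary_with_first_column[OF v] by blast
  define B where "B = mat_adjoint W * A * W"
  have B: "B \<in> carrier_mat ?N ?N" using A W by (auto simp: B_def)
  have BH: "mat_adjoint B = B"
    using A W H by (simp add: B_def adjoint_mult[of _ ?N ?N _ ?N] square_mat_simps[where n = ?N])
  have Bcol: "B $$ (i, 0) = (if i = 0 then e else 0)" if i: "i < ?N" for i
  proof -
    have "col B 0 = (mat_adjoint W * A) *\<^sub>v col W 0"
      unfolding B_def using A W by (subst col_mult2[of _ ?N ?N _ ?N]) auto
    also have "\<dots> = mat_adjoint W *\<^sub>v (A *\<^sub>v (c \<cdot>\<^sub>v v))"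
      using A W v col0 by (simp add: assoc_mult_mat_vec[of _ ?N ?N _ ?N])
    also have "A *\<^sub>v (c \<cdot>\<^sub>v v) = e \<cdot>\<^sub>v (c \<cdot>\<^sub>v v)"
      using A v ev by (simp add: mult_mat_vec[of _ ?N ?N] smult_smult_assoc mult.commute)
    also have "mat_adjoint W *\<^sub>v (e \<cdot>\<^sub>v (c \<cdot>\<^sub>v v)) = e \<cdot>\<^sub>v (mat_adjoint W *\<^sub>v col W 0)"
      using W v col0 by (simp add: mult_mat_vec[of _ ?N ?N])
    also have "mat_adjoint W *\<^sub>v col W 0 = col (mat_adjoint W * W) 0"
      using W by (subst col_mult2[of _ ?N ?N _ ?N]) auto
    finally have "col B 0 = e \<cdot>\<^sub>v col (1\<^sub>m ?N) 0" using W by simp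
    then have "col B 0 $ i = (e \<cdot>\<^sub>v col (1\<^sub>m ?N) 0) $ i" by simp
    then show ?thesis using B i by (simp split: if_splits)
  qed
  have BHi: "B $$ (i, j) = cnj (B $$ (j, i))" if "i < ?N" "j < ?N" for i j
    using BH index_adjoint[of i B j] that B by auto
  have Brow: "B $$ (0, i) = (if i = 0 then e else 0)" if i: "i < ?N" for i
  proof (cases "i = 0")
    case False
    then show ?thesis using BHi[of 0 i] Bcol[OF i] i by simp
  qed (use Bcol[of 0] in simp)
  \<comment> \<open>The eigenvalue is a diagonal entry of the Hermitian matrix
    \<open>B\<close>.\<close>
  have e: "e = complex_of_real (Re e)"
    using BHi[of 0 0] Bcol[of 0] by (simp add: complex_eq_iff)
  define B3 where "B3 = mat n n (\<lambda>(i, j). B $$ (Suc i, Suc j))"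
  have B3: "B3 \<in> carrier_mat n n" by (simp add: B3_def)
  have "mat_adjoint B3 = B3"
  proof (rule eq_matI)
    fix i j assume "i < dim_row B3" "j < dim_col B3"
    then show "mat_adjoint B3 $$ (i, j) = B3 $$ (i, j)"
      using BHi[of "Suc i" "Suc j"] B3 by (simp add: B3_def)
  qed (use B3 in auto)
  from Suc.IH[OF B3 this] obtain U d where U: "U \<in> carrier_mat n n" "mat_adjoint U * U = 1\<^sub>m n"
    and UB: "mat_adjoint U * B3 * U = mat_diag n (\<lambda>i. complex_of_real (d i))" by blast
  \<comment> \<open>The block sum of 1 and \<open>U\<close> keeps the first basis vector and
    diagonalizes the remaining block, so \<open>W * V\<close> diagonalizes \<open>A\<close>.\<close>
  define V where "V = mat ?N ?N (\<lambda>(i, j). case (i, j) of (0, 0) \<Rightarrow> 1 | (Suc i, Suc j) \<Rightarrow> U $$ (i, j) | _ \<Rightarrow> 0)"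
  have V: "V \<in> carrier_mat ?N ?N" by (simp add: V_def)
  have V_entries: "V $$ (0, 0) = 1" "\<And>i. i < n \<Longrightarrow> V $$ (Suc i, 0) = 0" "\<And>i. i < n \<Longrightarrow> V $$ (0, Suc i) = 0"
    "\<And>i j. i < n \<Longrightarrow> j < n \<Longrightarrow> V $$ (Suc i, Suc j) = U $$ (i, j)"
    by (auto simp: V_def)
  have VV: "mat_adjoint V * V = 1\<^sub>m ?N"
  proof (rule eq_matI)
    fix i j assume "i < dim_row (1\<^sub>m ?N :: complex mat)" "j < dim_col (1\<^sub>m ?N :: complex mat)"
    then have ij: "i < ?N" "j < ?N" by auto
    have U': "(\<Sum>r<n. cnj (U $$ (r, i)) * U $$ (r, j)) = (if i = j then 1 else 0)" if "i < n" "j < n" for i j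
    proof -
      have "(mat_adjoint U * U) $$ (i, j) = (\<Sum>r<n. mat_adjoint U $$ (i, r) * U $$ (r, j))"
        using U(1) that by (intro index_mult_sum[of _ n n _ n]) auto
      also have "\<dots> = (\<Sum>r<n. cnj (U $$ (r, i)) * U $$ (r, j))"
        using U(1) that by (intro sum.cong refl) auto
      finally show ?thesis using U(2) that by simp
    qed
    have "(mat_adjoint V * V) $$ (i, j) = (\<Sum>r<?N. cnj (V $$ (r, i)) * V $$ (r, j))"
      using V ij by (subst index_mult_sum[of _ ?N ?N _ ?N]) auto
    also have "\<dots> = 1\<^sub>m ?N $$ (i, j)"
      using ij by (cases i; cases j) (auto simp: sum.lessThan_Suc_shift V_entries U' simp del: sum.lessThan_Suc)
    finally show "(mat_adjoint V * V) $$ (i, j) = 1\<^sub>m ?N $$ (i, j)" .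
  qed (use V in auto)
  define d' where "d' = case_nat (Re e) d"
  have VBV: "mat_adjoint V * B * V = mat_diag ?N (\<lambda>i. complex_of_real (d' i))"
  proof (rule eq_matI)
    fix i j assume "i < dim_row (mat_diag ?N (\<lambda>i. complex_of_real (d' i)))"
      "j < dim_col (mat_diag ?N (\<lambda>i. complex_of_real (d' i)))"
    then have ij: "i < ?N" "j < ?N" by (auto simp: mat_diag_def)
    have U': "(\<Sum>s<n. (\<Sum>r<n. cnj (U $$ (r, i)) * B $$ (Suc r, Suc s)) * U $$ (s, j))
        = (if i = j then complex_of_real (d i) else 0)" if ij: "i < n" "j < n" for i j
    proof -
      have "(mat_adjoint U * B3 * U) $$ (i, j) = (\<Sum>s<n. (mat_adjoint U * B3) $$ (i, s) * U $$ (s, j))"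
        using U B3 ij by (intro index_mult_sum[of _ n n _ n]) auto
      also have "\<dots> = (\<Sum>s<n. (\<Sum>r<n. cnj (U $$ (r, i)) * B $$ (Suc r, Suc s)) * U $$ (s, j))"
        using U B3 ij by (intro sum.cong refl, subst index_mult_sum[of _ n n _ n]) (auto simp: B3_def)
      finally show ?thesis using UB ij by (simp add: mat_diag_def split: if_splits)
    qed
    have "(mat_adjoint V * B * V) $$ (i, j) = (\<Sum>s<?N. (mat_adjoint V * B) $$ (i, s) * V $$ (s, j))"
      using V B ij by (intro index_mult_sum[of _ ?N ?N _ ?N]) auto
    also have "\<dots> = (\<Sum>s<?N. (\<Sum>r<?N. cnj (V $$ (r, i)) * B $$ (r, s)) * V $$ (s, j))"
      using V B ij by (intro sum.cong refl, subst index_mult_sum[of _ ?N ?N _ ?N]) auto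
    also have "\<dots> = mat_diag ?N (\<lambda>i. complex_of_real (d' i)) $$ (i, j)"
      using ij e by (cases i; cases j)
        (auto simp: sum.lessThan_Suc_shift V_entries Bcol Brow U' mat_diag_def d'_def
          simp del: of_real_Re sum.lessThan_Suc)
    finally show "(mat_adjoint V * B * V) $$ (i, j) = mat_diag ?N (\<lambda>i. complex_of_real (d' i)) $$ (i, j)" .
  qed (use V B in \<open>auto simp: mat_diag_def\<close>)
  have "mat_adjoint (W * V) * A * (W * V) = mat_adjoint V * B * V"
    using W V A by (simp add: B_def adjoint_mult[of _ ?N ?N _ ?N] square_mat_simps[where n = ?N])
  with VBV unitary_mult[OF W V VV] W V show ?case
    by (intro exI[of _ "W * V"] exI[of _ d']) auto
qed

lemma conjugate_back:
  assumes U: "U \<in> carrier_mat n n" "mat_adjoint U * U = (1\<^sub>m n :: complex mat)"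
    and A: "A \<in> carrier_mat n n" and "mat_adjoint U * A * U = D"
  shows "A = U * D * mat_adjoint U"
proof -
  have "U * D * mat_adjoint U = (U * mat_adjoint U) * A * (U * mat_adjoint U)"
    using assms by (simp add: square_mat_simps[where n = n] flip: assms(4))
  then show ?thesis using left_unitary_right[OF U] A by simp
qed

subsection \<open>The positive square root and the trace norm\<close>

lemma psd_sqrt_exists:
  assumes A: "psd_mat n A"
  shows "\<exists>B. psd_mat n B \<and> B * B = A"
proof -
  have Ac: "A \<in> carrier_mat n n" using A by (simp add: psd_mat_def)
  obtain U d where U: "U \<in> carrier_mat n n" "mat_adjoint U * U = 1\<^sub>m n"
    and D: "mat_adjoint U * A * U = mat_diag n (\<lambda>i. complex_of_real (d i))"
    using hermitian_diagonalization[OF Ac psd_mat_hermitian[OF A]] by blast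
  have d: "d i \<ge> 0" if "i < n" for i
    using psd_mat_diag_nonneg[OF psd_mat_congruence[OF A U(1)], of i] that
    unfolding D by (simp add: mat_diag_def less_eq_complex_def)
  define E where "E = mat_diag n (\<lambda>i. complex_of_real (sqrt (d i)))"
  have E: "psd_mat n E" unfolding E_def by (rule psd_mat_diagonal) (use d in \<open>auto simp: less_eq_complex_def\<close>)
  have Ec: "E \<in> carrier_mat n n" by (simp add: E_def)
  have EE: "E * E = mat_diag n (\<lambda>i. complex_of_real (d i))"
    unfolding E_def mat_diag_diag using d by (intro eq_matI) (auto simp: mat_diag_def simp flip: of_real_mult)
  define B where "B = U * E * mat_adjoint U"
  have "psd_mat n B" using psd_mat_congruence[OF E, of "mat_adjoint U" n] U(1) by (simp add: B_def)
  moreover have "B * B = U * (E * (mat_adjoint U * U) * E) * mat_adjoint U"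
    using U(1) Ec by (simp add: B_def square_mat_simps[where n = n])
  then have "B * B = A"
    using U Ec EE conjugate_back[OF U Ac D] by simp
  ultimately show ?thesis by blast
qed

text \<open>
  In a basis that diagonalizes \<open>X = B - C\<close>, the diagonal of \<open>B X + X C = B\<^sup>2 - C\<^sup>2 = 0\<close> consists
  of the numbers \<open>x\<^sub>i (B\<^sub>i\<^sub>i + C\<^sub>i\<^sub>i)\<close>, where \<open>x\<^sub>i = B\<^sub>i\<^sub>i - C\<^sub>i\<^sub>i\<close>.
\<close>

lemma psd_sqrt_unique:
  assumes B: "psd_mat n B" and C: "psd_mat n C" and eq: "B * B = C * C"
  shows "B = C"
proof -
  have Bc: "B \<in> carrier_mat n n" and Cc: "C \<in> carrier_mat n n" using B C by (auto simp: psd_mat_def)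
  have Xc: "B - C \<in> carrier_mat n n" using Bc Cc by auto
  have "mat_adjoint (B - C) = B - C"
  proof (rule eq_matI)
    fix i j assume "i < dim_row (B - C)" "j < dim_col (B - C)"
    then have ij: "i < n" "j < n" using Bc Cc by auto
    then show "mat_adjoint (B - C) $$ (i, j) = (B - C) $$ (i, j)"
      using Bc Cc index_adjoint[of i B j] index_adjoint[of i C j]
        psd_mat_hermitian[OF B] psd_mat_hermitian[OF C] by (subst index_adjoint) auto
  qed (use Bc Cc in auto)
  then obtain U d where U: "U \<in> carrier_mat n n" "mat_adjoint U * U = 1\<^sub>m n"
    and D: "mat_adjoint U * (B - C) * U = mat_diag n (\<lambda>i. complex_of_real (d i))"
    using hermitian_diagonalization[OF Xc] by blast
  define conj where "conj M = mat_adjoint U * M * U" for M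
  have conj_carrier [simp]: "conj M \<in> carrier_mat n n" if "M \<in> carrier_mat n n" for M
    using U that by (auto simp: conj_def)
  have conj_minus: "conj (M - N) = conj M - conj N"
    if "M \<in> carrier_mat n n" "N \<in> carrier_mat n n" for M N
  proof -
    have "mat_adjoint U * M \<in> carrier_mat n n" "mat_adjoint U * N \<in> carrier_mat n n"
      using U(1) that by auto
    then show ?thesis
      using U that by (simp add: conj_def mult_minus_distrib_mat[of _ n n _ n] minus_mult_distrib_mat[of _ n n _ _ n])
  qed
  have conj_mult: "conj M * conj N = conj (M * N)"
    if "M \<in> carrier_mat n n" "N \<in> carrier_mat n n" for M N
  proof -
    have "conj M * conj N = mat_adjoint U * (M * (U * mat_adjoint U) * N) * U"
      using U(1) that by (simp add: conj_def square_mat_simps[where n = n])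
    then show ?thesis using left_unitary_right[OF U] that U(1) by (simp add: conj_def)
  qed
  have BC: "conj B - conj C = mat_diag n (\<lambda>i. complex_of_real (d i))"
    using D conj_minus[OF Bc Cc] by (simp add: conj_def)
  have diff: "conj B $$ (i, j) - conj C $$ (i, j) = (if i = j then complex_of_real (d i) else 0)"
    if ij: "i < n" "j < n" for i j
  proof -
    have "(conj B - conj C) $$ (i, j) = conj B $$ (i, j) - conj C $$ (i, j)"
      using ij conj_carrier[OF Cc] by auto
    then show ?thesis using ij unfolding BC by (auto simp: mat_diag_def split: if_splits)
  qed
  have "d i = 0" if i: "i < n" for i
  proof -
    have "(\<Sum>r<n. conj B $$ (i, r) * conj B $$ (r, i)) = (\<Sum>r<n. conj C $$ (i, r) * conj C $$ (r, i))"
      using conj_mult[OF Bc Bc] conj_mult[OF Cc Cc] eq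
        index_mult_sum[of "conj B" n n "conj B" n i i] index_mult_sum[of "conj C" n n "conj C" n i i] i Bc Cc
      by simp
    \<comment> \<open>The splitting \<open>B\<^sup>2 - C\<^sup>2 = B (B - C) + (B - C) C\<close>
      holds without commutation; as the difference is diagonal in this basis, only
      \<open>r = i\<close> survives.\<close>
    then have "0 = (\<Sum>r<n. conj B $$ (i, r) * (conj B $$ (r, i) - conj C $$ (r, i))
        + (conj B $$ (i, r) - conj C $$ (i, r)) * conj C $$ (r, i))"
      by (simp add: algebra_simps sum.distrib sum_subtractf)
    also have "\<dots> = (\<Sum>r<n. if r = i then conj B $$ (i, i) * d i + d i * conj C $$ (i, i) else 0)"
      using i diff by (intro sum.cong) auto
    also have "\<dots> = d i * (conj B $$ (i, i) + conj C $$ (i, i))"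
      using i by (simp add: algebra_simps)
    finally have zero: "d i * (conj B $$ (i, i) + conj C $$ (i, i)) = 0" by simp
    have "0 \<le> conj B $$ (i, i)" "0 \<le> conj C $$ (i, i)"
      unfolding conj_def using psd_mat_diag_nonneg psd_mat_congruence B C U(1) i by blast+
    \<comment> \<open>Two nonnegative numbers with sum 0 both vanish, but their difference is
      \<open>d i\<close>.\<close>
    then have "d i \<noteq> 0 \<longrightarrow> Re (conj B $$ (i, i)) = 0 \<and> Re (conj C $$ (i, i)) = 0"
      using zero by (auto simp: less_eq_complex_def complex_eq_iff)
    moreover have "Re (conj B $$ (i, i)) - Re (conj C $$ (i, i)) = d i"
      using arg_cong[OF diff[OF i i], of Re] by simp
    ultimately show ?thesis by force
  qed
  then have D0: "mat_diag n (\<lambda>i. complex_of_real (d i)) = 0\<^sub>m n n"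
    by (intro eq_matI) (auto simp: mat_diag_def)
  have "B - C = 0\<^sub>m n n"
    using conjugate_back[OF U Xc D] U by (simp add: D0)
  then have "(B - C) $$ (i, j) = 0" if "i < n" "j < n" for i j using that by simp
  then show ?thesis using Bc Cc by (intro eq_matI) auto
qed

text \<open>Makes the definite description in \<open>psd_sqrt\<close> denote; every bound on
  \<open>trace_norm\<close> goes through these two facts.\<close>

lemma psd_sqrt_props:
  assumes "psd_mat n A"
  shows "psd_mat n (psd_sqrt A)" "psd_sqrt A * psd_sqrt A = A"
proof -
  have n: "dim_row A = n" using assms by (auto simp: psd_mat_def)
  have "\<exists>!B. psd_mat n B \<and> B * B = A"
    using psd_sqrt_exists[OF assms] psd_sqrt_unique by blast
  from theI'[OF this] show "psd_mat n (psd_sqrt A)" "psd_sqrt A * psd_sqrt A = A"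
    unfolding psd_sqrt_def n by auto
qed

text \<open>Both sides are the trace of A* A: the root B is Hermitian, hence B* B = B B = A*
  A.\<close>

lemma psd_sqrt_frobenius:
  assumes A: "A \<in> carrier_mat n n"
  shows "(\<Sum>i<n. \<Sum>j<n. (cmod (psd_sqrt (mat_adjoint A * A) $$ (i, j)))\<^sup>2) = (\<Sum>i<n. \<Sum>j<n. (cmod (A $$ (i, j)))\<^sup>2)"
proof -
  have frob: "(\<Sum>i<n. \<Sum>j<n. (cmod (M $$ (i, j)))\<^sup>2) = Re (\<Sum>i<n. (mat_adjoint M * M) $$ (i, i))"
    if M: "M \<in> carrier_mat n n" for M
  proof -
    have "(\<Sum>i<n. (mat_adjoint M * M) $$ (i, i)) = complex_of_real (\<Sum>i<n. \<Sum>j<n. (cmod (M $$ (j, i)))\<^sup>2)"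
      using adjoint_mult_diag[OF M] by simp
    then show ?thesis by (subst sum.swap) simp
  qed
  let ?B = "psd_sqrt (mat_adjoint A * A)"
  have B: "psd_mat n ?B" "?B * ?B = mat_adjoint A * A"
    using psd_sqrt_props[OF psd_mat_adjoint_mult[OF A]] by auto
  then have "?B \<in> carrier_mat n n" by (simp add: psd_mat_def)
  from frob[OF this] frob[OF A] B psd_mat_hermitian[OF B(1)] show ?thesis by simp
qed

text \<open>The trace norm is the trace of the positive root. Cauchy-Schwarz against the all-ones
  vector bounds it by the diagonal entries, and the root has the same Frobenius norm as
  \<open>A\<close>.\<close>

lemma trace_norm_le_frobenius:
  assumes A: "A \<in> carrier_mat n n"
  shows "trace_norm A \<le> sqrt (n * (\<Sum>i<n. \<Sum>j<n. (cmod (A $$ (i, j)))\<^sup>2))"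
proof -
  define B where "B = psd_sqrt (mat_adjoint A * A)"
  have B: "psd_mat n B" unfolding B_def by (rule psd_sqrt_props(1)[OF psd_mat_adjoint_mult[OF A]])
  then have Bc: "B \<in> carrier_mat n n" by (simp add: psd_mat_def)
  have "(trace_norm A)\<^sup>2 = (\<Sum>i<n. 1 * Re (B $$ (i, i)))\<^sup>2"
    using Bc by (simp add: trace_norm_def mat_trace_def flip: B_def)
  also have "\<dots> \<le> (\<Sum>i<n. 1\<^sup>2) * (\<Sum>i<n. (Re (B $$ (i, i)))\<^sup>2)"
    by (rule Cauchy_Schwarz_ineq_sum)
  also have "\<dots> \<le> n * (\<Sum>i<n. (cmod (B $$ (i, i)))\<^sup>2)"
    by (auto intro!: mult_left_mono sum_mono sum_nonneg simp: cmod_power2)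
  also have "\<dots> \<le> n * (\<Sum>i<n. \<Sum>j<n. (cmod (B $$ (i, j)))\<^sup>2)"
    by (intro mult_left_mono sum_mono member_le_sum) auto
  also have "\<dots> = n * (\<Sum>i<n. \<Sum>j<n. (cmod (A $$ (i, j)))\<^sup>2)"
    unfolding B_def psd_sqrt_frobenius[OF A] ..
  finally show ?thesis by (rule real_le_rsqrt)
qed

text \<open>
  With an eigenbasis \<open>u\<^sub>j\<close> of \<open>\<bar>A\<bar>\<close> for the eigenvalues \<open>d\<^sub>j\<close> one has \<open>\<parallel>A u\<^sub>j\<parallel> = d\<^sub>j\<close>, so that each term
  of \<open>tr(Z A) = \<Sum>\<^sub>j \<langle>u\<^sub>j, Z A u\<^sub>j\<rangle>\<close> is bounded by \<open>d\<^sub>j\<close>.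
\<close>

lemma diagonal_functional_le_trace_norm:
  assumes A: "A \<in> carrier_mat n n" and z: "\<And>i. i < n \<Longrightarrow> cmod (z i) \<le> 1"
  shows "cmod (\<Sum>i<n. z i * A $$ (i, i)) \<le> trace_norm A"
proof -
  define B where "B = psd_sqrt (mat_adjoint A * A)"
  have B: "psd_mat n B" "B * B = mat_adjoint A * A"
    unfolding B_def by (rule psd_sqrt_props[OF psd_mat_adjoint_mult[OF A]])+
  then have Bc: "B \<in> carrier_mat n n" by (simp add: psd_mat_def)
  obtain U d where U: "U \<in> carrier_mat n n" "mat_adjoint U * U = 1\<^sub>m n"
    and D: "mat_adjoint U * B * U = mat_diag n (\<lambda>i. complex_of_real (d i))"
    using hermitian_diagonalization[OF Bc psd_mat_hermitian[OF B(1)]] by blast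
  let ?D = "mat_diag n (\<lambda>i. complex_of_real (d i))"
  have d: "d i \<ge> 0" if "i < n" for i
    using psd_mat_diag_nonneg[OF psd_mat_congruence[OF B(1) U(1)], of i] that
    unfolding D by (simp add: mat_diag_def less_eq_complex_def)
  have UU: "U * mat_adjoint U = 1\<^sub>m n" by (rule left_unitary_right[OF U])
  \<comment> \<open>The columns of \<open>C\<close> are the vectors A u_j.\<close>
  define C where "C = A * U"
  have C: "C \<in> carrier_mat n n" using A U by (simp add: C_def)
  have "mat_adjoint C * C = mat_adjoint U * (B * B) * U"
    using A U Bc by (simp add: C_def B(2) adjoint_mult[of _ n n _ n] square_mat_simps[where n = n])
  also have "\<dots> = mat_adjoint U * (B * (U * mat_adjoint U) * B) * U"
    using UU Bc by simp
  also have "\<dots> = ?D * ?D"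
    using U Bc by (simp add: square_mat_simps[where n = n] flip: D)
  finally have CC: "mat_adjoint C * C = ?D * ?D" .
  have col_norm: "(\<Sum>i<n. (cmod (C $$ (i, j)))\<^sup>2) = (d j)\<^sup>2" if j: "j < n" for j
  proof -
    have "complex_of_real (\<Sum>i<n. (cmod (C $$ (i, j)))\<^sup>2) = (mat_adjoint C * C) $$ (j, j)"
      using adjoint_mult_diag[OF C j] by simp
    also have "\<dots> = complex_of_real ((d j)\<^sup>2)"
      unfolding CC mat_diag_diag using j by (simp add: mat_diag_def power2_eq_square)
    finally show ?thesis by (simp only: of_real_eq_iff)
  qed
  have U_col: "(\<Sum>i<n. (cmod (U $$ (i, j)))\<^sup>2) = 1" if j: "j < n" for j
  proof -
    have "complex_of_real (\<Sum>i<n. (cmod (U $$ (i, j)))\<^sup>2) = (mat_adjoint U * U) $$ (j, j)"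
      using adjoint_mult_diag[OF U(1) j] by simp
    also have "\<dots> = 1" using U j by simp
    finally show ?thesis by (simp only: of_real_eq_1_iff)
  qed
  have AC: "A = C * mat_adjoint U"
    using A U UU by (simp add: C_def square_mat_simps[where n = n])
  have "(\<Sum>i<n. z i * A $$ (i, i)) = (\<Sum>i<n. \<Sum>j<n. z i * (C $$ (i, j) * cnj (U $$ (i, j))))"
  proof (intro sum.cong refl)
    fix i assume "i \<in> {..<n}"
    then show "z i * A $$ (i, i) = (\<Sum>j<n. z i * (C $$ (i, j) * cnj (U $$ (i, j))))"
      using C U by (subst AC, subst index_mult_sum[of _ n n _ n]) (auto simp: sum_distrib_left)
  qed
  also have "\<dots> = (\<Sum>j<n. \<Sum>i<n. z i * (C $$ (i, j) * cnj (U $$ (i, j))))"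
    by (rule sum.swap)
  also have "cmod \<dots> \<le> (\<Sum>j<n. d j)"
  proof (rule sum_norm_le)
    fix j assume "j \<in> {..<n}"
    then have j: "j < n" by simp
    have "cmod (\<Sum>i<n. z i * (C $$ (i, j) * cnj (U $$ (i, j)))) \<le> (\<Sum>i<n. cmod (C $$ (i, j)) * cmod (U $$ (i, j)))"
      using z by (intro sum_norm_le) (auto simp: norm_mult intro!: mult_left_le_one_le)
    also have "\<dots> \<le> sqrt ((\<Sum>i<n. (cmod (C $$ (i, j)))\<^sup>2) * (\<Sum>i<n. (cmod (U $$ (i, j)))\<^sup>2))"
      by (intro real_le_rsqrt Cauchy_Schwarz_ineq_sum)
    also have "\<dots> = d j" using col_norm[OF j] U_col[OF j] d[OF j] by simp
    finally show "cmod (\<Sum>i<n. z i * (C $$ (i, j) * cnj (U $$ (i, j)))) \<le> d j" .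
  qed
  also have "(\<Sum>j<n. d j) = trace_norm A"
  proof -
    let ?F = "\<lambda>i j. U $$ (i, j) * complex_of_real (d j) * cnj (U $$ (i, j))"
    have "(\<Sum>i<n. B $$ (i, i)) = (\<Sum>i<n. \<Sum>j<n. ?F i j)"
    proof (intro sum.cong refl)
      fix i assume "i \<in> {..<n}"
      then have i: "i < n" by simp
      have "B $$ (i, i) = (U * ?D * mat_adjoint U) $$ (i, i)"
        using conjugate_back[OF U Bc D] by simp
      also have "\<dots> = (\<Sum>j<n. ?F i j)"
        using U i by (subst index_mult_sum[of _ n n _ n]) (auto simp: mat_diag_mult_right[of _ n])
      finally show "B $$ (i, i) = (\<Sum>j<n. ?F i j)" .
    qed
    also have "\<dots> = (\<Sum>j<n. \<Sum>i<n. ?F i j)" by (rule sum.swap)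
    also have "\<dots> = (\<Sum>j<n. complex_of_real (d j * (\<Sum>i<n. (cmod (U $$ (i, j)))\<^sup>2)))"
      unfolding sum_distrib_left of_real_sum of_real_mult complex_norm_square
      by (intro sum.cong refl) (simp add: mult_ac)
    also have "\<dots> = complex_of_real (\<Sum>j<n. d j)" using U_col by simp
    finally show ?thesis using Bc by (simp add: trace_norm_def mat_trace_def flip: B_def)
  qed
  finally show ?thesis .
qed

subsection \<open>Tensor products\<close>

lemma sum_div_mod:
  fixes f :: "nat \<Rightarrow> nat \<Rightarrow> 'a :: comm_monoid_add"
  shows "(\<Sum>i<m * n. f (i div n) (i mod n)) = (\<Sum>a<m. \<Sum>b<n. f a b)"
proof (cases "n = 0")
  case False
  have "(\<Sum>a<m. \<Sum>b<n. f a b) = (\<Sum>(a, b)\<in>{..<m} \<times> {..<n}. f a b)"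
    by (simp add: sum.cartesian_product)
  also have "\<dots> = (\<Sum>i<m * n. f (i div n) (i mod n))"
  proof (rule sum.reindex_bij_witness[of _ "\<lambda>i. (i div n, i mod n)" "\<lambda>(a, b). a * n + b"])
    fix i assume "i \<in> {..<m * n}"
    then show "(i div n, i mod n) \<in> {..<m} \<times> {..<n}"
      using False by (auto simp: less_mult_imp_div_less)
  next
    fix p assume "p \<in> {..<m} \<times> {..<n}"
    then obtain a b where p: "p = (a, b)" "a < m" "b < n" by auto
    then have "a * n + b < Suc a * n" by simp
    also have "\<dots> \<le> m * n" using p by (intro mult_right_mono) auto
    finally show "(case p of (a, b) \<Rightarrow> a * n + b) \<in> {..<m * n}" using p by simp
  qed auto
  finally show ?thesis ..
qed simp

lemma dim_kron [simp]:
  "dim_row (kron A B) = dim_row A * dim_row B" "dim_col (kron A B) = dim_col A * dim_col B"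
  by (simp_all add: kron_def)

lemma index_kron:
  "i < dim_row A * dim_row B \<Longrightarrow> j < dim_col A * dim_col B \<Longrightarrow>
    kron A B $$ (i, j) = A $$ (i div dim_row B, j div dim_col B) * B $$ (i mod dim_row B, j mod dim_col B)"
  by (simp add: kron_def)

text \<open>\<open>kron_list\<close> nests to the right; associativity lets inductions over the
  number of qubits split off the last factor, which carries the least significant bit.\<close>

lemma kron_assoc: "kron (kron A B) C = kron A (kron B C)"
proof (rule eq_matI)
  fix i j assume "i < dim_row (kron A (kron B C))" "j < dim_col (kron A (kron B C))"
  then have ij: "i < dim_row A * dim_row B * dim_row C" "j < dim_col A * dim_col B * dim_col C"
    by (auto simp: mult.assoc)
  then have pos: "0 < dim_row B" "0 < dim_row C" "0 < dim_col B" "0 < dim_col C"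
    by (auto intro: gr0I)
  have *: "i div dim_row C < dim_row A * dim_row B" "j div dim_col C < dim_col A * dim_col B"
    "i mod (dim_row B * dim_row C) < dim_row B * dim_row C" "j mod (dim_col B * dim_col C) < dim_col B * dim_col C"
    using ij pos by (auto intro: less_mult_imp_div_less mod_less_divisor)
  have "kron (kron A B) C $$ (i, j) =
      A $$ (i div dim_row C div dim_row B, j div dim_col C div dim_col B) *
      B $$ (i div dim_row C mod dim_row B, j div dim_col C mod dim_col B) *
      C $$ (i mod dim_row C, j mod dim_col C)"
    using ij * by (simp add: index_kron)
  moreover have "kron A (kron B C) $$ (i, j) =
      A $$ (i div (dim_row B * dim_row C), j div (dim_col B * dim_col C)) *
      (B $$ (i mod (dim_row B * dim_row C) div dim_row C, j mod (dim_col B * dim_col C) div dim_col C) *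
      C $$ (i mod (dim_row B * dim_row C) mod dim_row C, j mod (dim_col B * dim_col C) mod dim_col C))"
    using ij * by (simp add: index_kron mult.assoc)
  moreover have "a div (b * c) = a div c div b" "a mod (b * c) div c = a div c mod b"
    "a mod (b * c) mod c = a mod c" if "c > 0" for a b c :: nat
    using that by (simp_all add: mult.commute[of b c] mod_mult2_eq div_mult2_eq)
  ultimately show "kron (kron A B) C $$ (i, j) = kron A (kron B C) $$ (i, j)"
    using pos by (simp only: mult.assoc)
qed (simp_all add: mult.assoc)

lemma kron_one [simp]: "kron (1\<^sub>m (Suc 0)) A = A" "kron A (1\<^sub>m (Suc 0)) = A"
  by (rule eq_matI; simp add: kron_def)+

lemma kron_list_simps [simp]:
  "kron_list [] = 1\<^sub>m 1" "kron_list (A # As) = kron A (kron_list As)"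
  by (simp_all add: kron_list_def)

lemma kron_list_append: "kron_list (As @ Bs) = kron (kron_list As) (kron_list Bs)"
  by (induction As) (auto simp: kron_assoc)

lemma mat_trace_mult:
  assumes "A \<in> carrier_mat n k" "B \<in> carrier_mat k n"
  shows "mat_trace (A * B) = (\<Sum>i<n. \<Sum>j<k. A $$ (i, j) * B $$ (j, i))"
  using assms by (auto simp: mat_trace_def scalar_prod_def atLeast0LessThan intro!: sum.cong)

lemma kron_carrier:
  "A \<in> carrier_mat a b \<Longrightarrow> B \<in> carrier_mat c d \<Longrightarrow> kron A B \<in> carrier_mat (a * c) (b * d)"
  by auto

text \<open>Quotient and remainder of both summation indices range independently, so the double sum
  for the trace splits into the sums for the two factors.\<close>

lemma mat_trace_kron_mult:
  assumes A: "A \<in> carrier_mat n n" and C: "C \<in> carrier_mat n n"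
    and B: "B \<in> carrier_mat k k" and D: "D \<in> carrier_mat k k"
  shows "mat_trace (kron A B * kron C D) = mat_trace (A * C) * mat_trace (B * D)"
proof -
  have "mat_trace (kron A B * kron C D)
      = (\<Sum>i<n * k. \<Sum>j<n * k. kron A B $$ (i, j) * kron C D $$ (j, i))"
    by (rule mat_trace_mult[OF kron_carrier[OF A B] kron_carrier[OF C D]])
  also have "\<dots> = (\<Sum>i<n * k. \<Sum>j<n * k. (A $$ (i div k, j div k) * C $$ (j div k, i div k)) *
      (B $$ (i mod k, j mod k) * D $$ (j mod k, i mod k)))"
    using A B C D by (intro sum.cong refl) (auto simp: index_kron)
  also have "\<dots> = (\<Sum>a<n. \<Sum>b<k. \<Sum>c<n. \<Sum>d<k. (A $$ (a, c) * C $$ (c, a)) * (B $$ (b, d) * D $$ (d, b)))"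
    by (simp only: sum_div_mod[of "\<lambda>c d. (A $$ (i div k, c) * C $$ (c, i div k)) * (B $$ (i mod k, d) * D $$ (d, i mod k))" for i]
        sum_div_mod[of "\<lambda>a b. \<Sum>c<n. \<Sum>d<k. (A $$ (a, c) * C $$ (c, a)) * (B $$ (b, d) * D $$ (d, b))"])
  also have "\<dots> = (\<Sum>a<n. \<Sum>c<n. A $$ (a, c) * C $$ (c, a)) * (\<Sum>b<k. \<Sum>d<k. B $$ (b, d) * D $$ (d, b))"
    by (simp only: sum_product)
  also have "\<dots> = mat_trace (A * C) * mat_trace (B * D)"
    by (simp only: mat_trace_mult[OF A C] mat_trace_mult[OF B D])
  finally show ?thesis .
qed

lemma kron_list_carrier:
  "(\<And>i. i < m \<Longrightarrow> A i \<in> carrier_mat d d) \<Longrightarrow> kron_list (map A [0..<m]) \<in> carrier_mat (d ^ m) (d ^ m)"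
proof (induction m)
  case (Suc m)
  then have "kron (kron_list (map A [0..<m])) (A m) \<in> carrier_mat (d ^ m * d) (d ^ m * d)"
    by (intro kron_carrier) auto
  then show ?case by (simp add: kron_list_append mult.commute)
qed auto

lemma mat_trace_kron_list_mult:
  assumes "\<And>i. i < m \<Longrightarrow> A i \<in> carrier_mat d d" "\<And>i. i < m \<Longrightarrow> B i \<in> carrier_mat d d"
  shows "mat_trace (kron_list (map A [0..<m]) * kron_list (map B [0..<m])) = (\<Prod>i<m. mat_trace (A i * B i))"
  using assms
proof (induction m)
  case 0
  then show ?case by (simp add: mat_trace_def)
next
  case (Suc m)
  have "mat_trace (kron_list (map A [0..<Suc m]) * kron_list (map B [0..<Suc m])) =
      mat_trace (kron (kron_list (map A [0..<m])) (A m) * kron (kron_list (map B [0..<m])) (B m))"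
    by (simp add: kron_list_append)
  also have "\<dots> = mat_trace (kron_list (map A [0..<m]) * kron_list (map B [0..<m])) * mat_trace (A m * B m)"
    using Suc.prems by (intro mat_trace_kron_mult[of _ "d ^ m" _ _ d]) (auto intro!: kron_list_carrier)
  finally show ?case using Suc by simp
qed

section \<open>Basis indices as bit strings\<close>

lemma qubit_Suc: "i < m \<Longrightarrow> qubit (Suc m) i c = qubit m i (c div 2)"
proof -
  assume "i < m"
  then have "Suc m - 1 - i = Suc (m - 1 - i)" by simp
  then show ?thesis by (simp add: qubit_def div_mult2_eq)
qed

lemma index_kron_list:
  assumes "\<And>i. i < m \<Longrightarrow> A i \<in> carrier_mat 2 2" "c < 2 ^ m" "d < 2 ^ m"
  shows "kron_list (map A [0..<m]) $$ (c, d) = (\<Prod>i<m. A i $$ (qubit m i c, qubit m i d))"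
  using assms
proof (induction m arbitrary: c d)
  case (Suc m)
  let ?K = "kron_list (map A [0..<m])"
  have K: "?K \<in> carrier_mat (2 ^ m) (2 ^ m)" and Am: "A m \<in> carrier_mat 2 2"
    using Suc.prems by (auto intro!: kron_list_carrier)
  have "kron_list (map A [0..<Suc m]) = kron ?K (A m)"
    by (simp add: kron_list_append)
  also have "\<dots> $$ (c, d) = ?K $$ (c div 2, d div 2) * A m $$ (c mod 2, d mod 2)"
    using K carrier_matD[OF Am] Suc.prems(2,3) by (subst index_kron) auto
  also have "?K $$ (c div 2, d div 2) = (\<Prod>i<m. A i $$ (qubit m i (c div 2), qubit m i (d div 2)))"
    using Suc.prems by (intro Suc.IH) auto
  also have "\<dots> = (\<Prod>i<m. A i $$ (qubit (Suc m) i c, qubit (Suc m) i d))"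
    by (intro prod.cong) (auto simp: qubit_Suc)
  finally show ?case by (simp add: qubit_def)
qed simp

lemma qubit_less [simp]: "qubit m i c < 2"
  by (simp add: qubit_def)

lemma qubit_eqI:
  assumes "c < 2 ^ m" "d < 2 ^ m" "\<And>i. i < m \<Longrightarrow> qubit m i c = qubit m i d"
  shows "c = d"
  using assms
proof (induction m arbitrary: c d)
  case (Suc m)
  have "c div 2 = d div 2"
  proof (rule Suc.IH)
    fix i assume "i < m"
    then show "qubit m i (c div 2) = qubit m i (d div 2)"
      using Suc.prems(3)[of i] qubit_Suc[of i m] by simp
  qed (use Suc.prems in auto)
  moreover have "c mod 2 = d mod 2" using Suc.prems(3)[of m] by (simp add: qubit_def)
  ultimately show ?case by (metis div_mult_mod_eq)
qed simp

text \<open>The bits of an index below 2^m range independently over {0, 1}. This evaluates the trace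
  and the Z-expectations of product states, and later isolates the restriction of an index.\<close>

lemma sum_pow2_qubits:
  fixes f :: "nat \<Rightarrow> nat \<Rightarrow> 'a :: comm_semiring_1"
  shows "(\<Sum>c<2 ^ m. \<Prod>i<m. f i (qubit m i c)) = (\<Prod>i<m. f i 0 + f i 1)"
proof (induction m)
  case (Suc m)
  have "(\<Sum>c<2 ^ Suc m. \<Prod>i<Suc m. f i (qubit (Suc m) i c))
      = (\<Sum>c<2 ^ m * 2. (\<Prod>i<m. f i (qubit m i (c div 2))) * f m (c mod 2))"
    by (intro sum.cong) (auto simp: qubit_Suc qubit_def[of "Suc m" m])
  also have "\<dots> = (\<Sum>a<2 ^ m. \<Sum>b<2. (\<Prod>i<m. f i (qubit m i a)) * f m b)"
    by (rule sum_div_mod[of "\<lambda>a b. (\<Prod>i<m. f i (qubit m i a)) * f m b"])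
  also have "\<dots> = (\<Prod>i<Suc m. f i 0 + f i 1)"
    unfolding sum_distrib_left[symmetric] sum_distrib_right[symmetric] Suc.IH
    by (simp add: numeral_2_eq_2)
  finally show ?case .
qed simp

subsection \<open>Outcome probabilities\<close>

text \<open>Groups the one-qubit effects by copy, to match the factors of the n-fold tensor power of
  \<rho>.\<close>

lemma kron_list_product:
  "kron_list (map (\<lambda>(t, i). f t i) (List.product xs ys)) = kron_list (map (\<lambda>t. kron_list (map (f t) ys)) xs)"
  by (induction xs) (auto simp: kron_list_append o_def)

lemma outcome_effect_psd:
  assumes "streaming_measurement n m M" "x \<in> outcomes n m M" "t < n" "i < m"
  shows "psd_mat 2 (M t i ! x (t, i))"
proof -
  have "x (t, i) < length (M t i)" using assms by (auto simp: outcomes_def PiE_iff)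
  then have "M t i ! x (t, i) \<in> set (M t i)" by simp
  then show ?thesis using assms unfolding streaming_measurement_def qubit_povm_def by blast
qed

text \<open>The copies are independent for every \<rho>, entangled or not. Independence of the
  qubits within a copy needs a product state and enters only in the lower bound.\<close>

lemma outcome_prob_prod:
  assumes M: "streaming_measurement n m M" and x: "x \<in> outcomes n m M"
    and \<rho>: "\<rho> \<in> carrier_mat (2 ^ m) (2 ^ m)"
  shows "outcome_prob n m M \<rho> x = Re (\<Prod>t<n. mat_trace (kron_list (map (\<lambda>i. M t i ! x (t, i)) [0..<m]) * \<rho>))"
proof -
  have eff: "M t i ! x (t, i) \<in> carrier_mat 2 2" if "t < n" "i < m" for t i
    using outcome_effect_psd[OF M x that] by (simp add: psd_mat_def)
  have "outcome_effect n m M x = kron_list (map (\<lambda>t. kron_list (map (\<lambda>i. M t i ! x (t, i)) [0..<m])) [0..<n])"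
    unfolding outcome_effect_def by (rule kron_list_product)
  moreover have "replicate n \<rho> = map (\<lambda>t. \<rho>) [0..<n]"
    by (simp add: map_replicate_const)
  ultimately show ?thesis
    unfolding outcome_prob_def using \<rho> eff
    by (simp add: mat_trace_kron_list_mult[of n _ "2 ^ m"] kron_list_carrier)
qed

text \<open>Outcomes are functions of pairs (t, i), while a product over copies needs one function
  of i for each t. The restrictions keep the curried functions extensional, as \<open>PiE\<close>
  demands.\<close>

lemma sum_PiE_curry:
  fixes F :: "('a \<Rightarrow> 'b \<Rightarrow> 'c) \<Rightarrow> 'd :: comm_monoid_add"
  shows "(\<Sum>x\<in>(\<Pi>\<^sub>E (a, b)\<in>A \<times> B. C a b). F (\<lambda>a\<in>A. \<lambda>b\<in>B. x (a, b)))
    = (\<Sum>g\<in>(\<Pi>\<^sub>E a\<in>A. PiE B (C a)). F g)"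
proof (rule sum.reindex_bij_witness[of _ "\<lambda>g. \<lambda>(a, b)\<in>A \<times> B. g a b" "\<lambda>x. \<lambda>a\<in>A. \<lambda>b\<in>B. x (a, b)"])
  fix g assume g: "g \<in> (\<Pi>\<^sub>E a\<in>A. PiE B (C a))"
  show "(\<lambda>a\<in>A. \<lambda>b\<in>B. (\<lambda>(a, b)\<in>A \<times> B. g a b) (a, b)) = g"
  proof
    fix a
    show "(\<lambda>a\<in>A. \<lambda>b\<in>B. (\<lambda>(a, b)\<in>A \<times> B. g a b) (a, b)) a = g a"
    proof (cases "a \<in> A")
      case True
      then have "g a \<in> extensional B" using g by (auto simp: PiE_def)
      with True show ?thesis by (auto simp: restrict_def fun_eq_iff extensional_def)
    qed (use g in \<open>auto simp: PiE_def extensional_def\<close>)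
  qed
  show "(\<lambda>(a, b)\<in>A \<times> B. g a b) \<in> (\<Pi>\<^sub>E (a, b)\<in>A \<times> B. C a b)"
    using g by (auto simp: PiE_iff)
next
  fix x assume x: "x \<in> (\<Pi>\<^sub>E (a, b)\<in>A \<times> B. C a b)"
  then have "x \<in> extensional (A \<times> B)" by (simp add: PiE_def)
  then show "(\<lambda>(a, b)\<in>A \<times> B. (\<lambda>a\<in>A. \<lambda>b\<in>B. x (a, b)) a b) = x"
    by (auto simp: restrict_def fun_eq_iff extensional_def)
  show "(\<lambda>a\<in>A. \<lambda>b\<in>B. x (a, b)) \<in> (\<Pi>\<^sub>E a\<in>A. PiE B (C a))"
    using x by (auto simp: PiE_iff)
qed simp

text \<open>Exchanging the components of the pairs groups the outcomes by qubit instead of by copy;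
  the sum of a product over qubits then factors.\<close>

lemma sum_PiE_prod_qubits:
  fixes f :: "'b \<Rightarrow> ('a \<Rightarrow> 'c) \<Rightarrow> 'd :: comm_semiring_1"
  assumes fin: "finite A" "finite B" "\<And>a b. a \<in> A \<Longrightarrow> b \<in> B \<Longrightarrow> finite (C a b)"
  shows "(\<Sum>x\<in>(\<Pi>\<^sub>E (a, b)\<in>A \<times> B. C a b). \<Prod>b\<in>B. f b (\<lambda>a\<in>A. x (a, b)))
    = (\<Prod>b\<in>B. \<Sum>y\<in>(\<Pi>\<^sub>E a\<in>A. C a b). f b y)"
proof -
  have "(\<Sum>x\<in>(\<Pi>\<^sub>E (a, b)\<in>A \<times> B. C a b). \<Prod>b\<in>B. f b (\<lambda>a\<in>A. x (a, b)))
     = (\<Sum>x\<in>(\<Pi>\<^sub>E (b, a)\<in>B \<times> A. C a b). \<Prod>b\<in>B. f b ((\<lambda>b\<in>B. \<lambda>a\<in>A. x (b, a)) b))"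
    by (rule sum.reindex_bij_witness[of _ "\<lambda>x. x \<circ> prod.swap" "\<lambda>x. x \<circ> prod.swap"])
      (auto simp: PiE_iff extensional_def)
  also have "\<dots> = (\<Sum>g\<in>(\<Pi>\<^sub>E b\<in>B. \<Pi>\<^sub>E a\<in>A. C a b). \<Prod>b\<in>B. f b (g b))"
    by (rule sum_PiE_curry[where F = "\<lambda>g. \<Prod>b\<in>B. f b (g b)"])
  also have "\<dots> = (\<Prod>b\<in>B. \<Sum>y\<in>(\<Pi>\<^sub>E a\<in>A. C a b). f b y)"
    using fin by (intro prod_sum_PiE[symmetric] finite_PiE) auto
  finally show ?thesis .
qed

subsection \<open>A Chernoff bound\<close>

text \<open>Meant for centred variables, where the linear term has expectation 0 and only exp (z^2)
  remains to bound the moment generating function. For z \<le> 1 the polynomial 1 + z + z^2 lies in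
  between; beyond 1, z \<le> z^2 suffices.\<close>

lemma exp_le_add_exp_square: "exp z \<le> z + exp (z\<^sup>2)" for z :: real
proof (cases "z \<le> 1")
  case True
  have *: "exp z \<le> 1 + z + z\<^sup>2"
  proof (cases "0 \<le> z")
    case True
    then show ?thesis using \<open>z \<le> 1\<close> by (rule exp_bound)
  next
    case False
    define w where "w = - z"
    have w: "w > 0" using False by (simp add: w_def)
    \<comment> \<open>The goal exp (- w) \<le> 1 - w + w^2 multiplied by exp w, with exp w replaced
      by its quadratic Taylor polynomial.\<close>
    have "1 \<le> (1 - w + w\<^sup>2) * (1 + w + w\<^sup>2 / 2)"
    proof -
      have "(1 - w + w\<^sup>2) * (1 + w + w\<^sup>2 / 2) = 1 + w\<^sup>2 / 2 + w ^ 3 / 2 + w ^ 4 / 2"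
        by (simp add: field_simps power2_eq_square power3_eq_cube power4_eq_xxxx)
      then show ?thesis using w by simp
    qed
    also have "\<dots> \<le> (1 - w + w\<^sup>2) * exp w"
    proof (rule mult_left_mono)
      show "1 + w + w\<^sup>2 / 2 \<le> exp w" using w exp_lower_Taylor_quadratic[of w] by simp
      have "1 - w + w\<^sup>2 = (1 - w / 2)\<^sup>2 + 3 / 4 * w\<^sup>2" by (simp add: power2_eq_square algebra_simps)
      then show "0 \<le> 1 - w + w\<^sup>2" by simp
    qed
    finally have "exp (- w) \<le> 1 - w + w\<^sup>2"
      by (simp add: exp_minus field_simps)
    then show ?thesis by (simp add: w_def)
  qed
  also have "\<dots> \<le> z + exp (z\<^sup>2)" using exp_ge_add_one_self[of "z\<^sup>2"] by simp
  finally show ?thesis .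
next
  case False
  then have "z \<le> z\<^sup>2" by (simp add: power2_eq_square)
  then have "exp z \<le> exp (z\<^sup>2)" by simp
  with False show ?thesis by linarith
qed

text \<open>Exponential Markov inequality: the indicator of the tail is at most an exponential,
  which factors over the copies. The centred variable is bounded by 2 * b, so each factor is at most
  exp (4 * b^2 * l^2).\<close>

lemma chernoff_upper_tail:
  fixes p h :: "'a \<Rightarrow> real" and n :: nat and b \<eta> \<mu> :: real
  assumes fin: "finite Y" and p: "\<And>y. y \<in> Y \<Longrightarrow> p y \<ge> 0" and total: "(\<Sum>y\<in>Y. p y) = 1"
    and h: "\<And>y. y \<in> Y \<Longrightarrow> \<bar>h y\<bar> \<le> b" and b: "b > 0" and \<eta>: "\<eta> \<ge> 0"
    and \<mu>: "(\<Sum>y\<in>Y. p y * h y) = \<mu>"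
  shows "(\<Sum>g\<in>{..<n} \<rightarrow>\<^sub>E Y. (\<Prod>t<n. p (g t)) * of_bool (n * \<eta> \<le> (\<Sum>t<n. h (g t) - \<mu>)))
    \<le> exp (- (n * \<eta>\<^sup>2 / (16 * b\<^sup>2)))"
proof -
  \<comment> \<open>Minimizes the exponent - l * \<eta> + 4 * b^2 * l^2 that each copy
    contributes.\<close>
  define l where "l = \<eta> / (8 * b\<^sup>2)"
  have l: "l \<ge> 0" using \<eta> by (simp add: l_def)
  have "\<bar>\<mu>\<bar> \<le> (\<Sum>y\<in>Y. \<bar>p y * h y\<bar>)" unfolding \<mu>[symmetric] by (rule sum_abs)
  also have "\<dots> \<le> (\<Sum>y\<in>Y. p y * b)"
    by (intro sum_mono) (use p h in \<open>auto simp: abs_mult intro!: mult_left_mono\<close>)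
  also have "\<dots> = b" using total by (simp flip: sum_distrib_right)
  finally have \<mu>_bound: "\<bar>\<mu>\<bar> \<le> b" .
  have mgf: "(\<Sum>y\<in>Y. p y * exp (l * (h y - \<mu>))) \<le> exp (4 * b\<^sup>2 * l\<^sup>2)"
  proof -
    have "(\<Sum>y\<in>Y. p y * exp (l * (h y - \<mu>))) \<le> (\<Sum>y\<in>Y. p y * (l * (h y - \<mu>) + exp (4 * b\<^sup>2 * l\<^sup>2)))"
    proof (intro sum_mono mult_left_mono p)
      fix y assume y: "y \<in> Y"
      have "\<bar>h y - \<mu>\<bar> \<le> 2 * b" using h[OF y] \<mu>_bound by linarith
      then have "(h y - \<mu>)\<^sup>2 \<le> (2 * b)\<^sup>2" using b by (intro abs_le_square_iff[THEN iffD1]) auto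
      then have "l\<^sup>2 * (h y - \<mu>)\<^sup>2 \<le> l\<^sup>2 * (2 * b)\<^sup>2" by (intro mult_left_mono) auto
      then have "(l * (h y - \<mu>))\<^sup>2 \<le> 4 * b\<^sup>2 * l\<^sup>2" by (simp add: power_mult_distrib mult_ac)
      then show "exp (l * (h y - \<mu>)) \<le> l * (h y - \<mu>) + exp (4 * b\<^sup>2 * l\<^sup>2)"
        using exp_le_add_exp_square[of "l * (h y - \<mu>)"] by (smt (verit) exp_le_cancel_iff)
    qed
    also have "\<dots> = l * ((\<Sum>y\<in>Y. p y * h y) - \<mu> * (\<Sum>y\<in>Y. p y)) + (\<Sum>y\<in>Y. p y) * exp (4 * b\<^sup>2 * l\<^sup>2)"
      by (simp add: algebra_simps sum.distrib sum_subtractf sum_distrib_left sum_distrib_right)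
    also have "\<dots> = exp (4 * b\<^sup>2 * l\<^sup>2)" using \<mu> total by simp
    finally show ?thesis .
  qed
  have "(\<Sum>g\<in>{..<n} \<rightarrow>\<^sub>E Y. (\<Prod>t<n. p (g t)) * of_bool (n * \<eta> \<le> (\<Sum>t<n. h (g t) - \<mu>)))
    \<le> (\<Sum>g\<in>{..<n} \<rightarrow>\<^sub>E Y. (\<Prod>t<n. p (g t)) * exp (l * ((\<Sum>t<n. h (g t) - \<mu>) - n * \<eta>)))"
  proof (intro sum_mono mult_left_mono prod_nonneg ballI)
    fix g t assume "g \<in> {..<n} \<rightarrow>\<^sub>E Y" "t \<in> {..<n}"
    then show "0 \<le> p (g t)" by (intro p) auto
  qed (use l in auto)
  also have "\<dots> = exp (- l * n * \<eta>) * (\<Sum>g\<in>{..<n} \<rightarrow>\<^sub>E Y. \<Prod>t<n. p (g t) * exp (l * (h (g t) - \<mu>)))"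
    unfolding sum_distrib_left
  proof (intro sum.cong refl)
    fix g
    have "(\<Prod>t<n. exp (l * (h (g t) - \<mu>))) = exp (l * (\<Sum>t<n. h (g t) - \<mu>))"
      by (simp only: exp_sum[OF finite_lessThan, symmetric] sum_distrib_left)
    then show "(\<Prod>t<n. p (g t)) * exp (l * ((\<Sum>t<n. h (g t) - \<mu>) - n * \<eta>)) =
        exp (- l * n * \<eta>) * (\<Prod>t<n. p (g t) * exp (l * (h (g t) - \<mu>)))"
      by (simp add: prod.distrib right_diff_distrib exp_diff exp_minus divide_inverse mult_ac del: sum_subtractf)
  qed
  also have "(\<Sum>g\<in>{..<n} \<rightarrow>\<^sub>E Y. \<Prod>t<n. p (g t) * exp (l * (h (g t) - \<mu>)))
      = (\<Sum>y\<in>Y. p y * exp (l * (h y - \<mu>))) ^ n"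
    using fin by (subst prod_sum_PiE[symmetric, of _ _ "\<lambda>t y. p y * exp (l * (h y - \<mu>))"]) auto
  also have "exp (- l * n * \<eta>) * \<dots> \<le> exp (- l * n * \<eta>) * exp (4 * b\<^sup>2 * l\<^sup>2) ^ n"
    using mgf p by (intro mult_left_mono power_mono sum_nonneg) auto
  also have "\<dots> = exp (- l * n * \<eta> + n * (4 * b\<^sup>2 * l\<^sup>2))"
    by (simp only: exp_add exp_of_nat_mult)
  also have "- l * n * \<eta> + n * (4 * b\<^sup>2 * l\<^sup>2) = - (n * \<eta>\<^sup>2 / (16 * b\<^sup>2))"
    using b by (simp add: l_def field_simps power2_eq_square)
  finally show ?thesis .
qed

lemma chernoff:
  fixes p h :: "'a \<Rightarrow> real" and n :: nat and b \<eta> \<mu> :: real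
  assumes fin: "finite Y" and p: "\<And>y. y \<in> Y \<Longrightarrow> p y \<ge> 0" and total: "(\<Sum>y\<in>Y. p y) = 1"
    and h: "\<And>y. y \<in> Y \<Longrightarrow> \<bar>h y\<bar> \<le> b" and b: "b > 0" and \<eta>: "\<eta> \<ge> 0"
    and \<mu>: "(\<Sum>y\<in>Y. p y * h y) = \<mu>" and n: "n > 0"
  shows "(\<Sum>g\<in>{..<n} \<rightarrow>\<^sub>E Y. (\<Prod>t<n. p (g t)) * of_bool (\<eta> < \<bar>(\<Sum>t<n. h (g t)) / n - \<mu>\<bar>))
    \<le> 2 * exp (- (n * \<eta>\<^sup>2 / (16 * b\<^sup>2)))"
proof -
  have p': "0 \<le> (\<Prod>t<n. p (g t))" if "g \<in> {..<n} \<rightarrow>\<^sub>E Y" for g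
    using that by (intro prod_nonneg) (auto intro!: p)
  have "(\<Sum>g\<in>{..<n} \<rightarrow>\<^sub>E Y. (\<Prod>t<n. p (g t)) * of_bool (\<eta> < \<bar>(\<Sum>t<n. h (g t)) / n - \<mu>\<bar>))
    \<le> (\<Sum>g\<in>{..<n} \<rightarrow>\<^sub>E Y. (\<Prod>t<n. p (g t)) * of_bool (n * \<eta> \<le> (\<Sum>t<n. h (g t) - \<mu>))
         + (\<Prod>t<n. p (g t)) * of_bool (n * \<eta> \<le> (\<Sum>t<n. - h (g t) - (- \<mu>))))"
  proof (intro sum_mono)
    fix g assume g: "g \<in> {..<n} \<rightarrow>\<^sub>E Y"
    define s where "s = (\<Sum>t<n. h (g t))"
    have s: "(\<Sum>t<n. h (g t) - \<mu>) = s - n * \<mu>" "(\<Sum>t<n. - h (g t) - (- \<mu>)) = n * \<mu> - s"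
      by (simp_all add: s_def sum_subtractf sum_negf)
    have "n * \<eta> \<le> s - n * \<mu> \<or> n * \<eta> \<le> n * \<mu> - s" if "\<eta> < \<bar>s / n - \<mu>\<bar>"
    proof -
      have "n * \<eta> < n * \<bar>s / n - \<mu>\<bar>" using that n by simp
      also have "\<dots> = \<bar>n * (s / n - \<mu>)\<bar>" by (simp add: abs_mult)
      also have "n * (s / n - \<mu>) = s - n * \<mu>" using n by (simp add: algebra_simps)
      finally show ?thesis by linarith
    qed
    then show "(\<Prod>t<n. p (g t)) * of_bool (\<eta> < \<bar>(\<Sum>t<n. h (g t)) / n - \<mu>\<bar>)
      \<le> (\<Prod>t<n. p (g t)) * of_bool (n * \<eta> \<le> (\<Sum>t<n. h (g t) - \<mu>))
         + (\<Prod>t<n. p (g t)) * of_bool (n * \<eta> \<le> (\<Sum>t<n. - h (g t) - (- \<mu>)))"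
      unfolding s using p'[OF g] by (auto simp: s_def[symmetric])
  qed
  also have "\<dots> \<le> exp (- (n * \<eta>\<^sup>2 / (16 * b\<^sup>2))) + exp (- (n * \<eta>\<^sup>2 / (16 * b\<^sup>2)))"
    unfolding sum.distrib using assms
    by (intro add_mono chernoff_upper_tail) (auto simp: sum_negf)
  finally show ?thesis by simp
qed

text \<open>Turns a product of conditions on single qubits into one condition on all of
  them.\<close>

lemma prod_one_zero:
  "finite A \<Longrightarrow> (\<Prod>i\<in>A. if Q i then 1 else 0) = (if \<forall>i\<in>A. Q i then 1 else (0 :: 'a :: comm_semiring_1))"
  by (induction A rule: finite_induct) auto

subsection \<open>Shadow estimation with the six-outcome Pauli measurement\<close>

text \<open>Eigenvectors of Z, X and Y, in this order, each time for the eigenvalues 1 and -1; they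
  are not normalized.\<close>

definition pauli_vec :: "nat \<Rightarrow> nat \<Rightarrow> complex" where
  "pauli_vec y b = [[1, 0], [0, 1], [1, 1], [1, - 1], [1, \<i>], [1, - \<i>]] ! y ! b"

text \<open>Each basis has probability 1/3. The last four vectors have squared norm 2, which a
  further factor 1/2 compensates, so every effect is a third of a projection.\<close>

definition pauli_weight :: "nat \<Rightarrow> real" where
  "pauli_weight y = (if y < 2 then 1 / 3 else 1 / 6)"

definition pauli_effect :: "nat \<Rightarrow> complex mat" where
  "pauli_effect y = mat 2 2 (\<lambda>(b, c). pauli_weight y * (pauli_vec y b * cnj (pauli_vec y c)))"

text \<open>
  The frame dual to the effects: \<open>\<rho> = \<Sum>\<^sub>y tr(E\<^sub>y \<rho>) (9 E\<^sub>y - 1)\<close>, since the measurement channel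
  \<open>\<rho> \<mapsto> \<Sum>\<^sub>y tr(E\<^sub>y \<rho>) 3 E\<^sub>y\<close> is \<open>(\<rho> + 1) / 3\<close> on states.
\<close>

definition shadow :: "nat \<Rightarrow> nat \<Rightarrow> nat \<Rightarrow> complex" where
  "shadow y a b = 9 * pauli_effect y $$ (a, b) - (if a = b then 1 else 0)"

lemma pauli_effect_carrier [simp]: "pauli_effect y \<in> carrier_mat 2 2"
  by (simp add: pauli_effect_def)

lemma less_6E:
  assumes "(y :: nat) < 6"
  obtains "y = 0" | "y = 1" | "y = 2" | "y = 3" | "y = 4" | "y = 5"
  using assms by linarith

lemma sum_less_6: "(\<Sum>y<6. f y) = f 0 + f 1 + f 2 + f 3 + f 4 + f (5 :: nat)"
  by (simp add: eval_nat_numeral add_ac)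

lemmas pauli_simps = pauli_effect_def pauli_vec_def pauli_weight_def

lemma sum_pauli_effect:
  assumes "c < 2" "d < 2"
  shows "(\<Sum>y<6. pauli_effect y $$ (c, d)) = (if c = d then 1 else 0)"
  using assms by (auto simp: sum_less_6 pauli_simps numeral_eq_Suc less_Suc_eq field_simps)

text \<open>The indices are paired crosswise because the trace of E \<rho> multiplies the entry (c,
  d) of E by the entry (d, c) of \<rho>; what comes out is the entry (a, b) of \<rho>.\<close>

lemma shadow_dual:
  assumes "a < 2" "b < 2" "c < 2" "d < 2"
  shows "(\<Sum>y<6. shadow y a b * pauli_effect y $$ (c, d)) = (if d = a \<and> c = b then 1 else 0)"
  using assms by (auto simp: sum_less_6 shadow_def pauli_simps numeral_eq_Suc less_Suc_eq field_simps)

text \<open>If v is the unit vector of outcome \<open>y\<close>, then \<open>shadow y\<close> is the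
  matrix 3 |v><v| - 1. Its entry 2 occurs for the computational basis; all others have modulus at
  most 3/2.\<close>

lemma cmod_shadow_le:
  assumes "y < 6" "a < 2" "b < 2"
  shows "cmod (shadow y a b) \<le> 2"
  using assms(1)
  by (cases rule: less_6E)
    (use assms(2,3) in \<open>auto simp: shadow_def pauli_simps numeral_eq_Suc less_Suc_eq cmod_def power2_eq_square
      intro!: real_le_lsqrt\<close>)

lemma psd_mat_rank_one:
  assumes "w \<ge> 0"
  shows "psd_mat n (mat n n (\<lambda>(b, c). complex_of_real w * (p b * cnj (p c))))"
proof -
  have "0 \<le> (mat n n (\<lambda>(b, c). complex_of_real w * (p b * cnj (p c))) *\<^sub>v v) \<bullet>c v"
    if v: "v \<in> carrier_vec n" for v
  proof -
    let ?z = "\<Sum>b<n. p b * cnj (v $ b)"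
    have "(mat n n (\<lambda>(b, c). complex_of_real w * (p b * cnj (p c))) *\<^sub>v v) \<bullet>c v
      = (\<Sum>b<n. \<Sum>c<n. w * (p b * cnj (p c)) * v $ c * cnj (v $ b))"
      using v by (subst quadratic_form_sum[of _ n]) auto
    also have "\<dots> = w * (?z * cnj ?z)"
      unfolding cnj_sum sum_product unfolding sum_distrib_left by (intro sum.cong refl) (simp add: mult_ac)
    also have "?z * cnj ?z = complex_of_real ((cmod ?z)\<^sup>2)"
      by (rule complex_norm_square[symmetric])
    also have "w * \<dots> \<ge> 0"
      using assms by (simp add: less_eq_complex_def flip: of_real_mult of_real_power)
    finally show ?thesis .
  qed
  then show ?thesis by (simp add: psd_mat_def)
qed

lemma foldr_add_mat:
  assumes "\<And>A. A \<in> set As \<Longrightarrow> A \<in> carrier_mat n n"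
  shows "foldr (+) As (0\<^sub>m n n) = mat n n (\<lambda>ij. \<Sum>A\<leftarrow>As. A $$ ij :: complex)"
  using assms
proof (induction As)
  case (Cons A As)
  then have "foldr (+) As (0\<^sub>m n n) = mat n n (\<lambda>ij. \<Sum>A\<leftarrow>As. A $$ ij)" by simp
  with Cons.prems show ?case by (intro eq_matI) auto
qed (auto intro!: eq_matI)

definition pauli_povm :: "complex mat list" where
  "pauli_povm = map pauli_effect [0..<6]"

lemma qubit_povm_pauli: "qubit_povm pauli_povm"
proof -
  have "psd_mat 2 (pauli_effect y)" for y
    unfolding pauli_effect_def by (rule psd_mat_rank_one) (simp add: pauli_weight_def)
  moreover have "foldr (+) pauli_povm (0\<^sub>m 2 2) = 1\<^sub>m 2"
  proof -
    have "foldr (+) pauli_povm (0\<^sub>m 2 2) = mat 2 2 (\<lambda>ij. \<Sum>A\<leftarrow>pauli_povm. A $$ ij)"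
      by (rule foldr_add_mat) (auto simp: pauli_povm_def)
    also have "\<dots> = 1\<^sub>m 2"
      by (intro eq_matI) (auto simp: pauli_povm_def o_def sum_pauli_effect
          interv_sum_list_conv_sum_set_nat atLeast0LessThan)
    finally show ?thesis .
  qed
  ultimately show ?thesis by (auto simp: qubit_povm_def pauli_povm_def)
qed

section \<open>Expectations under the outcome distribution of one copy\<close>

definition pauli_prob :: "nat \<Rightarrow> complex mat \<Rightarrow> (nat \<Rightarrow> nat) \<Rightarrow> complex" where
  "pauli_prob m \<rho> y = mat_trace (kron_list (map (\<lambda>i. pauli_effect (y i)) [0..<m]) * \<rho>)"

lemma pauli_prob_sum:
  assumes \<rho>: "\<rho> \<in> carrier_mat (2 ^ m) (2 ^ m)"
  shows "pauli_prob m \<rho> y =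
    (\<Sum>c<2 ^ m. \<Sum>d<2 ^ m. (\<Prod>i<m. pauli_effect (y i) $$ (qubit m i c, qubit m i d)) * \<rho> $$ (d, c))"
proof -
  have "pauli_prob m \<rho> y =
    (\<Sum>c<2 ^ m. \<Sum>d<2 ^ m. kron_list (map (\<lambda>i. pauli_effect (y i)) [0..<m]) $$ (c, d) * \<rho> $$ (d, c))"
    unfolding pauli_prob_def using \<rho> by (intro mat_trace_mult kron_list_carrier) auto
  then show ?thesis by (simp add: index_kron_list)
qed

text \<open>A tensor product of rank-one effects is w |P><P| with a product vector P, so the value
  is w times the quadratic form of \<rho> at P. In particular the complex number
  \<open>pauli_prob\<close> is real.\<close>

lemma pauli_prob_nonneg:
  assumes \<rho>: "psd_mat (2 ^ m) \<rho>"
  shows "0 \<le> pauli_prob m \<rho> y"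
proof -
  have \<rho>c: "\<rho> \<in> carrier_mat (2 ^ m) (2 ^ m)" using \<rho> by (simp add: psd_mat_def)
  define w where "w = (\<Prod>i<m. pauli_weight (y i))"
  define P where "P c = (\<Prod>i<m. pauli_vec (y i) (qubit m i c))" for c
  have w: "w \<ge> 0" unfolding w_def by (intro prod_nonneg) (auto simp: pauli_weight_def)
  have "pauli_prob m \<rho> y = (\<Sum>c<2 ^ m. \<Sum>d<2 ^ m. w * (P c * cnj (P d)) * \<rho> $$ (d, c))"
    unfolding pauli_prob_sum[OF \<rho>c]
    by (intro sum.cong refl) (simp add: pauli_effect_def w_def P_def prod.distrib)
  also have "\<dots> = w * (\<Sum>d<2 ^ m. \<Sum>c<2 ^ m. \<rho> $$ (d, c) * P c * cnj (P d))"
    by (subst sum.swap) (simp add: sum_distrib_left mult_ac)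
  also have "(\<Sum>d<2 ^ m. \<Sum>c<2 ^ m. \<rho> $$ (d, c) * P c * cnj (P d))
      = (\<rho> *\<^sub>v vec (2 ^ m) P) \<bullet>c vec (2 ^ m) P"
    using \<rho>c by (subst quadratic_form_sum[of _ "2 ^ m"]) auto
  also have "w * \<dots> \<ge> 0"
    using \<rho> w by (intro mult_nonneg_nonneg) (auto simp: psd_mat_def less_eq_complex_def)
  finally show ?thesis .
qed

text \<open>Expanding the trace in matrix entries leaves a product over qubits for each entry of
  \<rho>, which is averaged qubit by qubit. The factorization therefore also serves entangled
  states.\<close>

lemma pauli_expectation:
  assumes \<rho>: "\<rho> \<in> carrier_mat (2 ^ m) (2 ^ m)"
  shows "(\<Sum>y\<in>{..<m} \<rightarrow>\<^sub>E {..<6}. pauli_prob m \<rho> y * (\<Prod>i<m. g i (y i))) =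
    (\<Sum>c<2 ^ m. \<Sum>d<2 ^ m.
      (\<Prod>i<m. \<Sum>z<6. g i z * pauli_effect z $$ (qubit m i c, qubit m i d)) * \<rho> $$ (d, c))"
proof -
  let ?Y = "{..<m} \<rightarrow>\<^sub>E {..<6 :: nat}"
  let ?e = "\<lambda>y c d i. g i (y i) * pauli_effect (y i) $$ (qubit m i c, qubit m i d)"
  have "(\<Sum>y\<in>?Y. pauli_prob m \<rho> y * (\<Prod>i<m. g i (y i))) =
      (\<Sum>y\<in>?Y. \<Sum>c<2 ^ m. \<Sum>d<2 ^ m. (\<Prod>i<m. ?e y c d i) * \<rho> $$ (d, c))"
    unfolding pauli_prob_sum[OF \<rho>]
    by (simp add: sum_distrib_left sum_distrib_right prod.distrib mult_ac)
  also have "\<dots> = (\<Sum>c<2 ^ m. \<Sum>d<2 ^ m. (\<Sum>y\<in>?Y. \<Prod>i<m. ?e y c d i) * \<rho> $$ (d, c))"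
    unfolding sum_distrib_right
    by (subst sum.swap, rule sum.cong[OF refl], rule sum.swap)
  also have "\<dots> = (\<Sum>c<2 ^ m. \<Sum>d<2 ^ m.
      (\<Prod>i<m. \<Sum>z<6. g i z * pauli_effect z $$ (qubit m i c, qubit m i d)) * \<rho> $$ (d, c))"
    by (simp add: prod_sum_PiE)
  finally show ?thesis .
qed

lemma sum_pauli_prob:
  assumes "density_operator m \<rho>"
  shows "(\<Sum>y\<in>{..<m} \<rightarrow>\<^sub>E {..<6}. pauli_prob m \<rho> y) = 1"
proof -
  have \<rho>: "\<rho> \<in> carrier_mat (2 ^ m) (2 ^ m)" "mat_trace \<rho> = 1"
    using assms by (auto simp: density_operator_def psd_mat_def)
  have "(\<Sum>y\<in>{..<m} \<rightarrow>\<^sub>E {..<6}. pauli_prob m \<rho> y) =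
    (\<Sum>c<2 ^ m. \<Sum>d<2 ^ m. (\<Prod>i<m. if qubit m i c = qubit m i d then 1 else 0) * \<rho> $$ (d, c))"
    using pauli_expectation[OF \<rho>(1), of "\<lambda>_ _. 1"] by (simp add: sum_pauli_effect)
  also have "\<dots> = (\<Sum>c<2 ^ m. \<Sum>d<2 ^ m. if d = c then \<rho> $$ (d, c) else 0)"
  proof (intro sum.cong refl)
    fix c d :: nat assume "c \<in> {..<2 ^ m}" "d \<in> {..<2 ^ m}"
    then have "d \<noteq> c \<Longrightarrow> \<exists>i<m. qubit m i c \<noteq> qubit m i d" using qubit_eqI[of c m d] by auto
    then show "(\<Prod>i<m. if qubit m i c = qubit m i d then 1 else 0) * \<rho> $$ (d, c) = (if d = c then \<rho> $$ (d, c) else 0)"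
      unfolding prod_one_zero[OF finite_lessThan] by auto
  qed
  also have "\<dots> = 1" using \<rho> by (simp add: mat_trace_def)
  finally show ?thesis .
qed

text \<open>The entry (a, b) of the tensor product of the one-qubit shadows over \<open>S\<close>;
  \<open>card {j \<in> S. j < i}\<close> is the position of \<open>i\<close> in \<open>S\<close>, as
  in \<open>restricts_to\<close>.\<close>

definition local_shadow :: "nat set \<Rightarrow> nat \<Rightarrow> nat \<Rightarrow> (nat \<Rightarrow> nat) \<Rightarrow> complex" where
  "local_shadow S a b y = (\<Prod>i\<in>S. shadow (y i) (qubit (card S) (card {j \<in> S. j < i}) a)
     (qubit (card S) (card {j \<in> S. j < i}) b))"

text \<open>On the qubits of \<open>S\<close> duality forces the bits of \<open>a\<close> and
  \<open>b\<close>; on the others the estimator has factor 1, and completeness of the POVM forces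
  equal bits. These conditions together are the index set of the partial trace.\<close>

lemma local_shadow_unbiased:
  assumes \<rho>: "\<rho> \<in> carrier_mat (2 ^ m) (2 ^ m)" and S: "S \<subseteq> {..<m}"
    and ab: "a < 2 ^ card S" "b < 2 ^ card S"
  shows "(\<Sum>y\<in>{..<m} \<rightarrow>\<^sub>E {..<6}. pauli_prob m \<rho> y * local_shadow S a b y) = reduced_state m S \<rho> $$ (a, b)"
proof -
  let ?q = "\<lambda>i. qubit (card S) (card {j \<in> S. j < i})"
  define g where "g i z = (if i \<in> S then shadow z (?q i a) (?q i b) else 1)" for i z
  define P where "P d c \<longleftrightarrow> restricts_to m S d a \<and> restricts_to m S c b \<and>
    (\<forall>i<m. i \<notin> S \<longrightarrow> qubit m i d = qubit m i c)" for c d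
  have "local_shadow S a b y = (\<Prod>i<m. g i (y i))" for y
  proof -
    have "local_shadow S a b y = (\<Prod>i\<in>S. g i (y i))"
      unfolding local_shadow_def g_def by (intro prod.cong) auto
    also have "\<dots> = (\<Prod>i<m. g i (y i))"
      using S by (intro prod.mono_neutral_left) (auto simp: g_def)
    finally show ?thesis .
  qed
  then have "(\<Sum>y\<in>{..<m} \<rightarrow>\<^sub>E {..<6}. pauli_prob m \<rho> y * local_shadow S a b y) =
    (\<Sum>c<2 ^ m. \<Sum>d<2 ^ m.
      (\<Prod>i<m. \<Sum>z<6. g i z * pauli_effect z $$ (qubit m i c, qubit m i d)) * \<rho> $$ (d, c))"
    by (simp add: pauli_expectation[OF \<rho>])
  also have "\<dots> = (\<Sum>c<2 ^ m. \<Sum>d<2 ^ m. if P d c then \<rho> $$ (d, c) else 0)"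
  proof (intro sum.cong refl)
    fix c d
    have factor: "(\<Sum>z<6. g i z * pauli_effect z $$ (qubit m i c, qubit m i d)) =
      (if if i \<in> S then qubit m i d = ?q i a \<and> qubit m i c = ?q i b else qubit m i d = qubit m i c then 1 else 0)" for i
      by (auto simp: g_def sum_pauli_effect shadow_dual)
    have "P d c \<longleftrightarrow> (\<forall>i<m. if i \<in> S then qubit m i d = ?q i a \<and> qubit m i c = ?q i b else qubit m i d = qubit m i c)"
      using S by (auto simp: P_def restricts_to_def)
    then show "(\<Prod>i<m. \<Sum>z<6. g i z * pauli_effect z $$ (qubit m i c, qubit m i d)) * \<rho> $$ (d, c) =
      (if P d c then \<rho> $$ (d, c) else 0)"
      unfolding factor prod_one_zero[OF finite_lessThan] by auto
  qed
  also have "\<dots> = (\<Sum>d<2 ^ m. \<Sum>c<2 ^ m. if P d c then \<rho> $$ (d, c) else 0)"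
    by (rule sum.swap)
  also have "\<dots> = (\<Sum>(d, c)\<in>{..<2 ^ m} \<times> {..<2 ^ m}. if P d c then \<rho> $$ (d, c) else 0)"
    by (rule sum.cartesian_product)
  also have "\<dots> = (\<Sum>(d, c)\<in>{(d, c). d < 2 ^ m \<and> c < 2 ^ m \<and> P d c}. \<rho> $$ (d, c))"
    by (rule sum.mono_neutral_cong_right) (auto split: if_splits)
  also have "\<dots> = reduced_state m S \<rho> $$ (a, b)"
    using ab by (simp add: reduced_state_def P_def)
  finally show ?thesis .
qed

lemma cmod_local_shadow_le:
  assumes "S \<subseteq> {..<m}" "y \<in> {..<m} \<rightarrow>\<^sub>E {..<6}"
  shows "cmod (local_shadow S a b y) \<le> 2 ^ card S"
proof -
  have "cmod (local_shadow S a b y) \<le> (\<Prod>i\<in>S. 2)"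
    unfolding local_shadow_def prod_norm[symmetric]
    using assms by (intro prod_mono conjI norm_ge_zero cmod_shadow_le) auto
  then show ?thesis by simp
qed

subsection \<open>Upper bound\<close>

definition shadow_estimate :: "nat \<Rightarrow> (nat \<Rightarrow> nat \<Rightarrow> nat) \<Rightarrow> nat set \<Rightarrow> complex mat" where
  "shadow_estimate n g S = mat (2 ^ card S) (2 ^ card S) (\<lambda>(a, b). (\<Sum>t<n. local_shadow S a b (g t)) / n)"

text \<open>In the Frobenius bound, the dimension 2^k times the 4^k entries gives 8^k; the factor 2
  adds real and imaginary part.\<close>

lemma trace_norm_le_entries:
  assumes A: "A \<in> carrier_mat (2 ^ k) (2 ^ k)" and \<eta>: "\<eta> \<ge> 0"
    and entries: "\<And>a b. a < 2 ^ k \<Longrightarrow> b < 2 ^ k \<Longrightarrow> \<bar>Re (A $$ (a, b))\<bar> \<le> \<eta> \<and> \<bar>Im (A $$ (a, b))\<bar> \<le> \<eta>"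
  shows "trace_norm A \<le> sqrt (2 * 8 ^ k) * \<eta>"
proof -
  have "trace_norm A \<le> sqrt (real (2 ^ k) * (\<Sum>a<2 ^ k. \<Sum>b<2 ^ k. (cmod (A $$ (a, b)))\<^sup>2))"
    by (rule trace_norm_le_frobenius[OF A])
  also have "\<dots> \<le> sqrt (real (2 ^ k) * (\<Sum>a<(2 :: nat) ^ k. \<Sum>b<(2 :: nat) ^ k. 2 * \<eta>\<^sup>2))"
  proof (intro real_sqrt_le_mono mult_left_mono sum_mono)
    fix a b :: nat assume "a \<in> {..<2 ^ k}" "b \<in> {..<2 ^ k}"
    then have "\<bar>Re (A $$ (a, b))\<bar> \<le> \<bar>\<eta>\<bar>" "\<bar>Im (A $$ (a, b))\<bar> \<le> \<bar>\<eta>\<bar>"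
      using entries[of a b] \<eta> by auto
    then have "(Re (A $$ (a, b)))\<^sup>2 \<le> \<eta>\<^sup>2" "(Im (A $$ (a, b)))\<^sup>2 \<le> \<eta>\<^sup>2"
      by (simp_all only: abs_le_square_iff)
    then show "(cmod (A $$ (a, b)))\<^sup>2 \<le> 2 * \<eta>\<^sup>2" by (simp add: cmod_power2)
  qed simp
  also have "real (2 ^ k) * (\<Sum>a<(2 :: nat) ^ k. \<Sum>b<(2 :: nat) ^ k. 2 * \<eta>\<^sup>2) = 2 * 8 ^ k * \<eta>\<^sup>2"
    by (simp add: mult_ac flip: power_mult_distrib)
  also have "sqrt \<dots> = sqrt (2 * 8 ^ k) * \<eta>" using \<eta> by (simp add: real_sqrt_mult)
  finally show ?thesis .
qed

text \<open>
  Accuracy \<open>\<eta>\<close> in the real and imaginary part of every entry makes the trace norm error at most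
  \<open>\<epsilon>\<close>; the union bound runs over the two parts of the \<open>4 ^ k\<close> entries for each of the sets \<open>S\<close>.
\<close>

lemma pauli_failure_bound:
  assumes \<rho>: "density_operator m \<rho>" and \<eta>: "\<eta> \<ge> 0" "sqrt (2 * 8 ^ k) * \<eta> \<le> \<epsilon>" and n: "n > 0"
  shows "(\<Sum>g\<in>{..<n} \<rightarrow>\<^sub>E {..<m} \<rightarrow>\<^sub>E {..<6}. (\<Prod>t<n. Re (pauli_prob m \<rho> (g t))) *
      of_bool (\<not> accurate k m \<epsilon> \<rho> (shadow_estimate n g)))
    \<le> 4 * 4 ^ k * (m choose k) * exp (- (n * \<eta>\<^sup>2 / (16 * 4 ^ k)))"
proof -
  have \<rho>c: "\<rho> \<in> carrier_mat (2 ^ m) (2 ^ m)" and psd: "psd_mat (2 ^ m) \<rho>"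
    using \<rho> by (auto simp: density_operator_def psd_mat_def)
  let ?Y = "{..<m} \<rightarrow>\<^sub>E {..<6 :: nat}"
  let ?G = "{..<n} \<rightarrow>\<^sub>E ?Y"
  let ?p = "\<lambda>y. Re (pauli_prob m \<rho> y)"
  let ?W = "\<lambda>g. \<Prod>t<n. ?p (g t)"
  let ?SS = "{S. S \<subseteq> {..<m} \<and> card S = k}"
  let ?I = "?SS \<times> {..<2 ^ k :: nat} \<times> {..<2 ^ k :: nat}"
  \<comment> \<open>Abstracting over \<open>part\<close> lets real and imaginary part share one tail
    bound.\<close>
  define bad where "bad part g = (\<lambda>(S, a, b). \<eta> < \<bar>(\<Sum>t<n. part (local_shadow S a b (g t))) / n -
      part (reduced_state m S \<rho> $$ (a, b))\<bar>)" for part :: "complex \<Rightarrow> real" and g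
  have fin: "finite ?Y" "finite ?G" by (auto intro!: finite_PiE)
  have p: "?p y \<ge> 0" "pauli_prob m \<rho> y = complex_of_real (?p y)" for y
    using pauli_prob_nonneg[OF psd, of y] by (auto simp: less_eq_complex_def complex_eq_iff)
  have total: "(\<Sum>y\<in>?Y. ?p y) = 1"
    using arg_cong[OF sum_pauli_prob[OF \<rho>], of Re] by simp
  have W: "?W g \<ge> 0" for g by (intro prod_nonneg ballI p)
  have finS: "finite ?SS" by (rule finite_subset[of _ "Pow {..<m}"]) auto
  have cardI: "real (card ?I) = 4 ^ k * (m choose k)"
    using n_subsets[of "{..<m}" k] by (simp add: card_cartesian_product mult_ac flip: power_mult_distrib)
  have union: "of_bool (\<not> accurate k m \<epsilon> \<rho> (shadow_estimate n g)) \<le>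
      (\<Sum>j\<in>?I. of_bool (bad Re g j) + of_bool (bad Im g j) :: real)" for g
  proof (cases "\<exists>j\<in>?I. bad Re g j \<or> bad Im g j")
    case True
    then obtain j where j: "j \<in> ?I" "bad Re g j \<or> bad Im g j" by blast
    have "of_bool (\<not> accurate k m \<epsilon> \<rho> (shadow_estimate n g)) \<le> (of_bool (bad Re g j) + of_bool (bad Im g j) :: real)"
      using j(2) by auto
    also have "\<dots> \<le> (\<Sum>j\<in>?I. of_bool (bad Re g j) + of_bool (bad Im g j))"
      using j(1) finS by (intro member_le_sum) auto
    finally show ?thesis .
  next
    case False
    have "accurate k m \<epsilon> \<rho> (shadow_estimate n g)"
      unfolding accurate_def
    proof (intro allI impI conjI)
      fix S assume S: "S \<subseteq> {..<m} \<and> card S = k"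
      then show "shadow_estimate n g S \<in> carrier_mat (2 ^ k) (2 ^ k)" by (simp add: shadow_estimate_def)
      have "trace_norm (shadow_estimate n g S - reduced_state m S \<rho>) \<le> sqrt (2 * 8 ^ k) * \<eta>"
      proof (rule trace_norm_le_entries)
        show "shadow_estimate n g S - reduced_state m S \<rho> \<in> carrier_mat (2 ^ k) (2 ^ k)"
          using S by (auto simp: shadow_estimate_def reduced_state_def)
        fix a b :: nat assume ab: "a < 2 ^ k" "b < 2 ^ k"
        then have "(shadow_estimate n g S - reduced_state m S \<rho>) $$ (a, b) =
          (\<Sum>t<n. local_shadow S a b (g t)) / n - reduced_state m S \<rho> $$ (a, b)"
          using S by (simp add: shadow_estimate_def reduced_state_def)
        moreover have "\<not> bad Re g (S, a, b)" "\<not> bad Im g (S, a, b)" using False S ab by auto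
        ultimately show "\<bar>Re ((shadow_estimate n g S - reduced_state m S \<rho>) $$ (a, b))\<bar> \<le> \<eta> \<and>
          \<bar>Im ((shadow_estimate n g S - reduced_state m S \<rho>) $$ (a, b))\<bar> \<le> \<eta>"
          by (simp add: bad_def)
      qed (rule \<eta>)
      then show "trace_norm (shadow_estimate n g S - reduced_state m S \<rho>) \<le> \<epsilon>" using \<eta>(2) by simp
    qed
    then show ?thesis by (simp add: sum_nonneg)
  qed
  have tail: "(\<Sum>g\<in>?G. ?W g * of_bool (bad part g j)) \<le> 2 * exp (- (n * \<eta>\<^sup>2 / (16 * 4 ^ k)))"
    if j: "j \<in> ?I" and part: "part = Re \<or> part = Im" for j and part :: "complex \<Rightarrow> real"
  proof -
    obtain S a b where j_def: "j = (S, a, b)" by (cases j) auto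
    have S: "S \<subseteq> {..<m}" "card S = k" and ab: "a < 2 ^ card S" "b < 2 ^ card S" using j j_def by auto
    have mean: "(\<Sum>y\<in>?Y. ?p y * part (local_shadow S a b y)) = part (reduced_state m S \<rho> $$ (a, b))"
    proof -
      have "part (\<Sum>y\<in>?Y. complex_of_real (?p y) * local_shadow S a b y) = part (reduced_state m S \<rho> $$ (a, b))"
        using local_shadow_unbiased[OF \<rho>c S(1) ab] by (simp only: p(2)[symmetric])
      then show ?thesis using part by auto
    qed
    have "\<bar>part (local_shadow S a b y)\<bar> \<le> 2 ^ k" if "y \<in> ?Y" for y
      using cmod_local_shadow_le[OF S(1) that, of a b] part S(2) abs_Re_le_cmod abs_Im_le_cmod order_trans by metis
    from chernoff[OF fin(1) p(1) total this _ \<eta>(1) mean n]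
    have "(\<Sum>g\<in>?G. ?W g * of_bool (bad part g j)) \<le> 2 * exp (- (n * \<eta>\<^sup>2 / (16 * (2 ^ k)\<^sup>2)))"
      by (simp add: bad_def j_def)
    also have "(2 ^ k)\<^sup>2 = (4 ^ k :: real)" by (simp add: power2_eq_square flip: power_mult_distrib)
    finally show ?thesis .
  qed
  have "(\<Sum>g\<in>?G. ?W g * of_bool (\<not> accurate k m \<epsilon> \<rho> (shadow_estimate n g)))
    \<le> (\<Sum>g\<in>?G. ?W g * (\<Sum>j\<in>?I. of_bool (bad Re g j) + of_bool (bad Im g j)))"
    using W union by (intro sum_mono mult_left_mono) auto
  also have "\<dots> = (\<Sum>j\<in>?I. (\<Sum>g\<in>?G. ?W g * of_bool (bad Re g j)) + (\<Sum>g\<in>?G. ?W g * of_bool (bad Im g j)))"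
    unfolding sum_distrib_left distrib_left
    by (subst sum.swap) (simp only: sum.distrib)
  also have "\<dots> \<le> (\<Sum>j\<in>?I. 2 * exp (- (n * \<eta>\<^sup>2 / (16 * 4 ^ k))) + 2 * exp (- (n * \<eta>\<^sup>2 / (16 * 4 ^ k))))"
    by (intro sum_mono add_mono tail) auto
  \<comment> \<open>The leading 4 is two parts times two tails.\<close>
  also have "\<dots> = 4 * 4 ^ k * (m choose k) * exp (- (n * \<eta>\<^sup>2 / (16 * 4 ^ k)))"
    by (simp only: sum_constant cardI) simp
  finally show ?thesis .
qed

section \<open>The Pauli measurement as a streaming algorithm\<close>

lemma outcomes_pauli:
  "outcomes n m (\<lambda>_ _. pauli_povm) = (\<Pi>\<^sub>E (t, i)\<in>{..<n} \<times> {..<m}. {..<6})"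
  by (simp add: outcomes_def pauli_povm_def)

lemma outcome_prob_pauli:
  assumes x: "x \<in> outcomes n m (\<lambda>_ _. pauli_povm)" and \<rho>: "density_operator m \<rho>"
  shows "outcome_prob n m (\<lambda>_ _. pauli_povm) \<rho> x =
    (\<Prod>t<n. Re (pauli_prob m \<rho> ((\<lambda>t\<in>{..<n}. \<lambda>i\<in>{..<m}. x (t, i)) t)))"
proof -
  have psd: "psd_mat (2 ^ m) \<rho>" using \<rho> by (simp add: density_operator_def)
  have real: "pauli_prob m \<rho> y = complex_of_real (Re (pauli_prob m \<rho> y))" for y
    using pauli_prob_nonneg[OF psd, of y] by (simp add: less_eq_complex_def complex_eq_iff)
  have x6: "x (t, i) < 6" if "t < n" "i < m" for t i
    using x that by (auto simp: outcomes_pauli PiE_iff)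
  have "outcome_prob n m (\<lambda>_ _. pauli_povm) \<rho> x =
      Re (\<Prod>t<n. mat_trace (kron_list (map (\<lambda>i. pauli_povm ! x (t, i)) [0..<m]) * \<rho>))"
    using x psd qubit_povm_pauli
    by (intro outcome_prob_prod) (auto simp: streaming_measurement_def psd_mat_def)
  also have "(\<Prod>t<n. mat_trace (kron_list (map (\<lambda>i. pauli_povm ! x (t, i)) [0..<m]) * \<rho>)) =
      (\<Prod>t<n. pauli_prob m \<rho> ((\<lambda>t\<in>{..<n}. \<lambda>i\<in>{..<m}. x (t, i)) t))"
    unfolding pauli_prob_def using x6
    by (intro prod.cong refl arg_cong[where f = mat_trace] arg_cong2[where f = "(*)"] arg_cong[where f = kron_list] map_cong)
      (auto simp: pauli_povm_def)
  also have "\<dots> = complex_of_real (\<Prod>t<n. Re (pauli_prob m \<rho> ((\<lambda>t\<in>{..<n}. \<lambda>i\<in>{..<m}. x (t, i)) t)))"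
    by (simp only: real[symmetric] of_real_prod)
  finally show ?thesis by (simp only: Re_complex_of_real)
qed

lemma streaming_tomography_possible_if:
  assumes n: "n > 0" and \<epsilon>: "\<epsilon> > 0"
    and bound: "4 * 4 ^ k * (m choose k) * exp (- (n * \<epsilon>\<^sup>2 / (32 * 32 ^ k))) \<le> 1 / 3"
  shows "streaming_tomography_possible k m \<epsilon> n"
proof -
  let ?M = "\<lambda>_ _ :: nat. pauli_povm"
  let ?curry = "\<lambda>x :: nat \<times> nat \<Rightarrow> nat. \<lambda>t\<in>{..<n}. \<lambda>i\<in>{..<m}. x (t, i)"
  let ?D = "\<lambda>x. return_pmf (shadow_estimate n (?curry x))"
  let ?G = "{..<n} \<rightarrow>\<^sub>E {..<m} \<rightarrow>\<^sub>E {..<6 :: nat}"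
  have "success_prob k m \<epsilon> n ?M ?D \<rho> \<ge> 2 / 3" if \<rho>: "density_operator m \<rho>" for \<rho>
  proof -
    \<comment> \<open>The largest entrywise error for which \<open>trace_norm_le_entries\<close>
      still gives \<epsilon>. In the exponent this produces 32 = 16 * 2 and 32^k = 4^k *
      8^k.\<close>
    define \<eta> where "\<eta> = \<epsilon> / sqrt (2 * 8 ^ k)"
    have \<eta>: "\<eta> \<ge> 0" "sqrt (2 * 8 ^ k) * \<eta> \<le> \<epsilon>" using \<epsilon> by (auto simp: \<eta>_def)
    have "n * \<eta>\<^sup>2 / (16 * 4 ^ k) = n * \<epsilon>\<^sup>2 / (32 * (8 ^ k * 4 ^ k))"
      by (simp add: \<eta>_def power_divide)
    also have "\<dots> = n * \<epsilon>\<^sup>2 / (32 * 32 ^ k)"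
      by (simp flip: power_mult_distrib)
    finally have exponent: "n * \<eta>\<^sup>2 / (16 * 4 ^ k) = n * \<epsilon>\<^sup>2 / (32 * 32 ^ k)" .
    let ?W = "\<lambda>g. \<Prod>t<n. Re (pauli_prob m \<rho> (g t))"
    have "success_prob k m \<epsilon> n ?M ?D \<rho> = (\<Sum>x\<in>outcomes n m ?M.
        ?W (?curry x) * of_bool (accurate k m \<epsilon> \<rho> (shadow_estimate n (?curry x))))"
      unfolding success_prob_def
      by (intro sum.cong refl arg_cong2[where f = "(*)"] outcome_prob_pauli \<rho>) (auto simp: indicator_def)
    also have "\<dots> = (\<Sum>g\<in>?G. ?W g * of_bool (accurate k m \<epsilon> \<rho> (shadow_estimate n g)))"
      unfolding outcomes_pauli
      by (rule sum_PiE_curry[where F = "\<lambda>g. ?W g * of_bool (accurate k m \<epsilon> \<rho> (shadow_estimate n g))"])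
    also have "\<dots> = (\<Sum>g\<in>?G. ?W g) -
        (\<Sum>g\<in>?G. ?W g * of_bool (\<not> accurate k m \<epsilon> \<rho> (shadow_estimate n g)))"
      by (simp add: sum_subtractf[symmetric] of_bool_def algebra_simps) (intro sum.cong, auto)
    also have "(\<Sum>g\<in>?G. ?W g) = (\<Prod>t<n. \<Sum>y\<in>{..<m} \<rightarrow>\<^sub>E {..<6}. Re (pauli_prob m \<rho> y))"
      by (rule prod_sum_PiE[symmetric]) (auto intro!: finite_PiE)
    also have "\<dots> = 1"
      using arg_cong[OF sum_pauli_prob[OF \<rho>], of Re] by simp
    finally show ?thesis
      using pauli_failure_bound[OF \<rho> \<eta> n] bound unfolding exponent by linarith
  qed
  then show ?thesis unfolding streaming_tomography_possible_def
    using qubit_povm_pauli by (intro exI[of _ ?M] exI[of _ ?D]) (auto simp: streaming_measurement_def)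
qed

text \<open>An exponent of 3 * L cancels the binomial coefficient and divides by 6^(3 k) = 216^k,
  leaving a failure probability of at most 4 * (4 / 216)^k. The factor 96 is 3 * 32, and 97 pays for
  rounding up, since the quantity multiplied by it is at least 1.\<close>

lemma sample_complexity_upper:
  assumes k: "1 \<le> k" "k \<le> m" and \<epsilon>: "0 < \<epsilon>" "\<epsilon> \<le> 1"
  shows "ereal_of_enat (sample_complexity k m \<epsilon>)
    \<le> ereal (97 * (108 ^ k * (log 2 (real (m choose k)) + real k * log 2 6) / \<epsilon>\<^sup>2))"
proof -
  define L where "L = log 2 (real (m choose k)) + real k * log 2 6"
  define n where "n = nat \<lceil>96 * (108 ^ k * L / \<epsilon>\<^sup>2)\<rceil>"
  have C: "real (m choose k) \<ge> 1" using k by (simp add: Suc_leI)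
  have ln2: "0 < ln (2 :: real)" "ln (2 :: real) \<le> 1" using ln_le_minus_one[of 2] by simp_all
  have ln_le_log: "ln x \<le> log 2 x" if "x \<ge> 1" for x :: real
    using ln2 that mult_left_le[of "ln 2" "ln x"] by (simp add: log_def field_simps)
  have "log 2 (6 :: real) \<ge> log 2 2" by (subst log_le_cancel_iff) auto
  then have log6: "log 2 (6 :: real) \<ge> 1" by simp
  have L1: "L \<ge> 1"
  proof -
    have "1 * 1 \<le> real k * log 2 6" using k log6 by (intro mult_mono) auto
    moreover have "0 \<le> log 2 (real (m choose k))" using C by (subst zero_le_log_cancel_iff) linarith+
    ultimately show ?thesis by (simp add: L_def)
  qed
  have L_ln: "ln (real (m choose k)) + 3 * real k * ln 6 \<le> 3 * L"
  proof -
    have "ln (real (m choose k)) \<le> 3 * log 2 (real (m choose k))"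
      using ln_le_log[OF C] C by (smt (verit) zero_le_log_cancel_iff)
    moreover have "real k * ln 6 \<le> real k * log 2 6" using ln_le_log[of 6] by (intro mult_left_mono) auto
    ultimately show ?thesis by (simp add: L_def)
  qed
  have big: "108 ^ k * L / \<epsilon>\<^sup>2 \<ge> 1"
  proof -
    have "\<epsilon>\<^sup>2 \<le> 1" using \<epsilon> by (simp add: power_le_one)
    moreover have "1 * 1 \<le> 108 ^ k * L" using L1 by (intro mult_mono) auto
    ultimately show ?thesis using \<epsilon> by (simp add: field_simps)
  qed
  have n_lower: "real n \<ge> 96 * (108 ^ k * L / \<epsilon>\<^sup>2)" and n_upper: "real n \<le> 97 * (108 ^ k * L / \<epsilon>\<^sup>2)"
  proof -
    define z where "z = 108 ^ k * L / \<epsilon>\<^sup>2"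
    have "real n = of_int \<lceil>96 * z\<rceil>" using big by (simp add: n_def z_def)
    moreover have "z \<ge> 1" using big by (simp add: z_def)
    ultimately have "96 * z \<le> real n" "real n \<le> 97 * z" by linarith+
    then show "real n \<ge> 96 * (108 ^ k * L / \<epsilon>\<^sup>2)" "real n \<le> 97 * (108 ^ k * L / \<epsilon>\<^sup>2)"
      by (simp_all only: z_def)
  qed
  have n0: "n > 0" using n_lower big by (cases n) auto
  have exponent: "3 * L \<le> n * \<epsilon>\<^sup>2 / (32 * 32 ^ k)"
  proof -
    \<comment> \<open>The slack between 32^k and 108^k is given away here.\<close>
    have "3 * L * 32 ^ k \<le> 3 * L * 108 ^ k" using L1 by (intro mult_left_mono power_mono) auto
    also have "\<dots> = 96 * (108 ^ k * L / \<epsilon>\<^sup>2) * \<epsilon>\<^sup>2 / 32" using \<epsilon> by simp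
    also have "\<dots> \<le> n * \<epsilon>\<^sup>2 / 32" using n_lower by (intro divide_right_mono mult_right_mono) auto
    finally show ?thesis by (simp add: field_simps)
  qed
  have "exp (- (n * \<epsilon>\<^sup>2 / (32 * 32 ^ k))) \<le> exp (- (ln (real (m choose k)) + 3 * real k * ln 6))"
    using exponent L_ln by simp
  also have "\<dots> = 1 / (real (m choose k) * 216 ^ k)"
  proof -
    have "exp (3 * real k * ln 6) = exp (real (3 * k) * ln 6)" by simp
    also have "\<dots> = (exp (ln 6) ^ 3) ^ k" by (simp only: exp_of_nat_mult power_mult)
    finally have "exp (3 * real k * ln 6) = (exp (ln 6) ^ 3) ^ k" .
    then have "exp (3 * real k * ln 6) = 216 ^ k" by simp
    then show ?thesis using k by (simp add: exp_minus exp_diff inverse_eq_divide)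
  qed
  finally have "4 * 4 ^ k * (m choose k) * exp (- (n * \<epsilon>\<^sup>2 / (32 * 32 ^ k)))
     \<le> 4 * 4 ^ k * (m choose k) * (1 / (real (m choose k) * 216 ^ k))"
    by (intro mult_left_mono) auto
  also have "\<dots> = 4 * (4 / 216) ^ k"
    unfolding power_divide using k by simp
  also have "\<dots> \<le> 4 * (4 / 216) ^ 1" using k by (intro mult_left_mono power_decreasing) auto
  also have "\<dots> \<le> 1 / 3" by simp
  finally have "streaming_tomography_possible k m \<epsilon> n"
    using n0 \<epsilon> by (intro streaming_tomography_possible_if)
  then have "sample_complexity k m \<epsilon> \<le> enat n"
    unfolding sample_complexity_def by (intro Inf_lower) auto
  then have "ereal_of_enat (sample_complexity k m \<epsilon>) \<le> ereal_of_enat (enat n)"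
    by (simp only: ereal_of_enat_le_iff)
  also have "\<dots> \<le> ereal (97 * (108 ^ k * L / \<epsilon>\<^sup>2))" using n_upper by simp
  finally show ?thesis unfolding L_def .
qed

subsection \<open>Lower bound\<close>

text \<open>The diagonal of (1 + \<delta> Z) / 2 for \<open>s = True\<close> and of (1 - \<delta> Z)
  / 2 for \<open>s = False\<close>.\<close>

definition bias_weight :: "real \<Rightarrow> bool \<Rightarrow> nat \<Rightarrow> real" where
  "bias_weight \<delta> s b = (1 + (if s = (b = 0) then \<delta> else - \<delta>)) / 2"

definition biased_qubit :: "real \<Rightarrow> bool \<Rightarrow> complex mat" where
  "biased_qubit \<delta> s = mat_diag 2 (\<lambda>b. complex_of_real (bias_weight \<delta> s b))"

definition biased_state :: "nat \<Rightarrow> real \<Rightarrow> (nat \<Rightarrow> bool) \<Rightarrow> complex mat" where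
  "biased_state m \<delta> s = kron_list (map (\<lambda>i. biased_qubit \<delta> (s i)) [0..<m])"

lemma bias_weight_nonneg: "\<bar>\<delta>\<bar> \<le> 1 \<Longrightarrow> 0 \<le> bias_weight \<delta> s b"
  by (auto simp: bias_weight_def)

lemma biased_qubit_carrier [simp]: "biased_qubit \<delta> s \<in> carrier_mat 2 2"
  by (simp add: biased_qubit_def)

lemma biased_state_carrier: "biased_state m \<delta> s \<in> carrier_mat (2 ^ m) (2 ^ m)"
  unfolding biased_state_def by (rule kron_list_carrier) simp

lemma index_biased_state:
  assumes "c < 2 ^ m" "d < 2 ^ m"
  shows "biased_state m \<delta> s $$ (c, d) =
    (if c = d then complex_of_real (\<Prod>i<m. bias_weight \<delta> (s i) (qubit m i c)) else 0)"
proof -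
  have eq: "biased_state m \<delta> s $$ (c, d) = (\<Prod>i<m. biased_qubit \<delta> (s i) $$ (qubit m i c, qubit m i d))"
    unfolding biased_state_def using assms by (intro index_kron_list) auto
  show ?thesis
  proof (cases "c = d")
    case True
    then show ?thesis unfolding eq by (simp add: biased_qubit_def mat_diag_def)
  next
    case False
    then obtain i where i: "i < m" "qubit m i c \<noteq> qubit m i d" using qubit_eqI[OF assms] by blast
    then have "biased_qubit \<delta> (s i) $$ (qubit m i c, qubit m i d) = 0"
      by (simp add: biased_qubit_def mat_diag_def)
    then have "(\<Prod>i<m. biased_qubit \<delta> (s i) $$ (qubit m i c, qubit m i d)) = 0"
      using i(1) by (intro prod_zero) auto
    then show ?thesis using False by (simp add: eq)
  qed
qed

lemma density_operator_biased_state: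
  assumes \<delta>: "\<bar>\<delta>\<bar> \<le> 1"
  shows "density_operator m (biased_state m \<delta> s)"
proof -
  have "biased_state m \<delta> s = mat_diag (2 ^ m) (\<lambda>c. complex_of_real (\<Prod>i<m. bias_weight \<delta> (s i) (qubit m i c)))"
    using biased_state_carrier[of m \<delta> s] by (intro eq_matI) (auto simp: index_biased_state mat_diag_def)
  moreover have "psd_mat (2 ^ m) (mat_diag (2 ^ m) (\<lambda>c. complex_of_real (\<Prod>i<m. bias_weight \<delta> (s i) (qubit m i c))))"
    by (intro psd_mat_diagonal) (auto simp: less_eq_complex_def intro!: prod_nonneg bias_weight_nonneg \<delta> simp del: of_real_prod)
  moreover have "mat_trace (biased_state m \<delta> s) = 1"
  proof -
    have "mat_trace (biased_state m \<delta> s) = complex_of_real (\<Sum>c<2 ^ m. \<Prod>i<m. bias_weight \<delta> (s i) (qubit m i c))"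
      using biased_state_carrier[of m \<delta> s] by (simp add: mat_trace_def index_biased_state)
    also have "\<dots> = 1"
      by (simp add: sum_pow2_qubits[where f = "\<lambda>i b. bias_weight \<delta> (s i) b"])
        (simp add: bias_weight_def add_divide_distrib[symmetric])
    finally show ?thesis .
  qed
  ultimately show ?thesis by (simp add: density_operator_def)
qed

section \<open>Statistics of the biased states under product measurements\<close>

definition effect_prob :: "real \<Rightarrow> complex mat \<Rightarrow> bool \<Rightarrow> real" where
  "effect_prob \<delta> E s = Re (E $$ (0, 0)) * bias_weight \<delta> s 0 + Re (E $$ (1, 1)) * bias_weight \<delta> s 1"

text \<open>The biased qubit is diagonal, so only the diagonal of the effect contributes: the
  measurement acts as a classical channel on a biased bit.\<close>

lemma mat_trace_biased_qubit:
  assumes E: "psd_mat 2 E"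
  shows "mat_trace (E * biased_qubit \<delta> s) = complex_of_real (effect_prob \<delta> E s)"
proof -
  have Ec: "E \<in> carrier_mat 2 2" using E by (simp add: psd_mat_def)
  have diag: "E $$ (i, i) = complex_of_real (Re (E $$ (i, i)))" if "i < 2" for i
    using psd_mat_diag_nonneg[OF E that] by (simp add: less_eq_complex_def complex_eq_iff)
  have "mat_trace (E * biased_qubit \<delta> s) = E $$ (0, 0) * bias_weight \<delta> s 0 + E $$ (1, 1) * bias_weight \<delta> s 1"
    by (subst mat_trace_mult[OF Ec biased_qubit_carrier])
      (simp add: biased_qubit_def mat_diag_def numeral_2_eq_2)
  also have "\<dots> = complex_of_real (effect_prob \<delta> E s)"
    using diag[of 0] diag[of 1] by (simp add: effect_prob_def)
  finally show ?thesis .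
qed

text \<open>State and measurement both factor over the qubits, so the outcomes of different qubits
  are independent. Exchanging the products groups the data by qubit, each group being governed by a
  single sign.\<close>

lemma outcome_prob_biased_state:
  assumes M: "streaming_measurement n m M" and x: "x \<in> outcomes n m M"
  shows "outcome_prob n m M (biased_state m \<delta> s) x = (\<Prod>i<m. \<Prod>t<n. effect_prob \<delta> (M t i ! x (t, i)) (s i))"
proof -
  have psd: "psd_mat 2 (M t i ! x (t, i))" if "t < n" "i < m" for t i
    using outcome_effect_psd[OF M x that] .
  have "outcome_prob n m M (biased_state m \<delta> s) x =
      Re (\<Prod>t<n. mat_trace (kron_list (map (\<lambda>i. M t i ! x (t, i)) [0..<m]) * biased_state m \<delta> s))"
    by (rule outcome_prob_prod[OF M x biased_state_carrier])
  also have "(\<Prod>t<n. mat_trace (kron_list (map (\<lambda>i. M t i ! x (t, i)) [0..<m]) * biased_state m \<delta> s)) =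
      (\<Prod>t<n. \<Prod>i<m. mat_trace (M t i ! x (t, i) * biased_qubit \<delta> (s i)))"
    unfolding biased_state_def
    by (intro prod.cong refl mat_trace_kron_list_mult[of _ _ 2]) (use psd in \<open>auto simp: psd_mat_def\<close>)
  also have "\<dots> = (\<Prod>t<n. \<Prod>i<m. complex_of_real (effect_prob \<delta> (M t i ! x (t, i)) (s i)))"
    by (intro prod.cong refl mat_trace_biased_qubit) (use psd in auto)
  also have "\<dots> = complex_of_real (\<Prod>t<n. \<Prod>i<m. effect_prob \<delta> (M t i ! x (t, i)) (s i))"
    by simp
  also have "(\<Prod>t<n. \<Prod>i<m. effect_prob \<delta> (M t i ! x (t, i)) (s i)) =
      (\<Prod>i<m. \<Prod>t<n. effect_prob \<delta> (M t i ! x (t, i)) (s i))"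
    by (rule prod.swap)
  finally show ?thesis by (simp only: Re_complex_of_real)
qed

lemma effect_prob_nonneg: "psd_mat 2 E \<Longrightarrow> \<bar>\<delta>\<bar> \<le> 1 \<Longrightarrow> 0 \<le> effect_prob \<delta> E s"
  using psd_mat_diag_nonneg[of 2 E 0] psd_mat_diag_nonneg[of 2 E 1] bias_weight_nonneg[of \<delta>]
  by (auto simp: effect_prob_def less_eq_complex_def)

lemma sum_povm_diag:
  assumes Es: "qubit_povm Es" and b: "b < 2"
  shows "(\<Sum>y<length Es. Re (Es ! y $$ (b, b))) = 1"
proof -
  have "foldr (+) Es (0\<^sub>m 2 2) = mat 2 2 (\<lambda>ij. \<Sum>A\<leftarrow>Es. A $$ ij)"
    using Es by (intro foldr_add_mat) (auto simp: qubit_povm_def psd_mat_def)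
  then have "mat 2 2 (\<lambda>ij. \<Sum>A\<leftarrow>Es. A $$ ij) = 1\<^sub>m 2"
    using Es by (simp add: qubit_povm_def)
  from arg_cong[OF this, of "\<lambda>A. A $$ (b, b)"] have "(\<Sum>A\<leftarrow>Es. A $$ (b, b)) = 1"
    using b by simp
  then have "(\<Sum>y<length Es. Es ! y $$ (b, b)) = 1"
    using b by (simp add: sum_list_sum_nth atLeast0LessThan)
  from arg_cong[OF this, of Re] show ?thesis by simp
qed

lemma sum_effect_prob:
  assumes "qubit_povm Es"
  shows "(\<Sum>y<length Es. effect_prob \<delta> (Es ! y) s) = 1"
proof -
  have "(\<Sum>y<length Es. effect_prob \<delta> (Es ! y) s) = bias_weight \<delta> s 0 + bias_weight \<delta> s 1"
    using sum_povm_diag[OF assms] by (simp add: effect_prob_def sum.distrib flip: sum_distrib_right)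
  also have "\<dots> = 1" by (simp add: bias_weight_def add_divide_distrib[symmetric])
  finally show ?thesis .
qed

text \<open>The left-hand side is the fidelity of the two biased qubits, below which no measurement
  can push the Bhattacharyya coefficient. For an effect with diagonal u, v the product of the two
  probabilities is (1 - \<delta>^2) ((u + v) / 2)^2 + u v \<delta>^2, and the numbers (u + v) / 2
  sum to 1.\<close>

lemma sum_sqrt_effect_prob:
  assumes Es: "qubit_povm Es" and \<delta>: "\<bar>\<delta>\<bar> \<le> 1"
  shows "sqrt (1 - \<delta>\<^sup>2) \<le> (\<Sum>y<length Es. sqrt (effect_prob \<delta> (Es ! y) True * effect_prob \<delta> (Es ! y) False))"
proof -
  have d: "0 \<le> 1 - \<delta>\<^sup>2" using \<delta> by (simp add: abs_square_le_1)
  have "sqrt (1 - \<delta>\<^sup>2) = (\<Sum>y<length Es. sqrt (1 - \<delta>\<^sup>2) * ((Re (Es ! y $$ (0, 0)) + Re (Es ! y $$ (1, 1))) / 2))"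
    using sum_povm_diag[OF Es] by (simp add: sum.distrib flip: sum_distrib_left sum_divide_distrib)
  also have "\<dots> \<le> (\<Sum>y<length Es. sqrt (effect_prob \<delta> (Es ! y) True * effect_prob \<delta> (Es ! y) False))"
  proof (intro sum_mono real_le_rsqrt)
    fix y assume "y \<in> {..<length Es}"
    then have "psd_mat 2 (Es ! y)" using Es by (auto simp: qubit_povm_def)
    then have nonneg: "0 \<le> Re (Es ! y $$ (0, 0))" "0 \<le> Re (Es ! y $$ (1, 1))"
      using psd_mat_diag_nonneg[of 2 "Es ! y" 0] psd_mat_diag_nonneg[of 2 "Es ! y" 1]
      by (auto simp: less_eq_complex_def)
    define u v where "u = Re (Es ! y $$ (0, 0))" and "v = Re (Es ! y $$ (1, 1))"
    have "effect_prob \<delta> (Es ! y) True * effect_prob \<delta> (Es ! y) False =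
        (1 - \<delta>\<^sup>2) * ((u + v) / 2)\<^sup>2 + u * v * \<delta>\<^sup>2"
      unfolding effect_prob_def u_def[symmetric] v_def[symmetric]
      by (simp add: bias_weight_def field_simps power2_eq_square)
    also have "\<dots> \<ge> (1 - \<delta>\<^sup>2) * ((u + v) / 2)\<^sup>2" using nonneg by (simp add: u_def v_def)
    also have "(1 - \<delta>\<^sup>2) * ((u + v) / 2)\<^sup>2 = (sqrt (1 - \<delta>\<^sup>2) * ((u + v) / 2))\<^sup>2"
      using d by (simp only: power_mult_distrib real_sqrt_pow2)
    finally show "(sqrt (1 - \<delta>\<^sup>2) * ((Re (Es ! y $$ (0, 0)) + Re (Es ! y $$ (1, 1))) / 2))\<^sup>2
        \<le> effect_prob \<delta> (Es ! y) True * effect_prob \<delta> (Es ! y) False"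
      by (simp only: u_def v_def)
  qed
  finally show ?thesis .
qed

text \<open>
  The left-hand side is twice the success probability of the optimal test between the two product
  distributions; the Bhattacharyya coefficient, which is multiplicative, bounds its error from below.
\<close>

lemma sum_max_prod_le:
  fixes p q :: "nat \<Rightarrow> 'a \<Rightarrow> real"
  assumes fin: "\<And>t. t < n \<Longrightarrow> finite (Y t)"
    and p: "\<And>t y. t < n \<Longrightarrow> y \<in> Y t \<Longrightarrow> p t y \<ge> 0" "\<And>t. t < n \<Longrightarrow> (\<Sum>y\<in>Y t. p t y) = 1"
    and q: "\<And>t y. t < n \<Longrightarrow> y \<in> Y t \<Longrightarrow> q t y \<ge> 0" "\<And>t. t < n \<Longrightarrow> (\<Sum>y\<in>Y t. q t y) = 1"
    and overlap: "\<And>t. t < n \<Longrightarrow> \<beta> \<le> (\<Sum>y\<in>Y t. sqrt (p t y * q t y))" and \<beta>: "\<beta> \<ge> 0"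
  shows "(\<Sum>z\<in>(\<Pi>\<^sub>E t\<in>{..<n}. Y t). max (\<Prod>t<n. p t (z t)) (\<Prod>t<n. q t (z t))) \<le> 2 - (\<beta>\<^sup>2) ^ n / 2"
proof -
  let ?Z = "\<Pi>\<^sub>E t\<in>{..<n}. Y t"
  define P Q where "P z = (\<Prod>t<n. p t (z t))" and "Q z = (\<Prod>t<n. q t (z t))" for z
  have nonneg: "P z \<ge> 0" "Q z \<ge> 0" if "z \<in> ?Z" for z
    unfolding P_def Q_def using that by (auto intro!: prod_nonneg p q)
  have "(\<Sum>z\<in>?Z. P z) = (\<Prod>t<n. \<Sum>y\<in>Y t. p t y)" "(\<Sum>z\<in>?Z. Q z) = (\<Prod>t<n. \<Sum>y\<in>Y t. q t y)"
    unfolding P_def Q_def by (intro prod_sum_PiE[symmetric]; use fin in simp)+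
  then have total: "(\<Sum>z\<in>?Z. P z) = 1" "(\<Sum>z\<in>?Z. Q z) = 1" using p(2) q(2) by simp_all
  have "\<beta> ^ n = (\<Prod>t<n. \<beta>)" by simp
  also have "\<dots> \<le> (\<Prod>t<n. \<Sum>y\<in>Y t. sqrt (p t y * q t y))"
    using overlap \<beta> by (intro prod_mono) auto
  also have "\<dots> = (\<Sum>z\<in>?Z. \<Prod>t<n. sqrt (p t (z t) * q t (z t)))"
    using fin by (intro prod_sum_PiE) auto
  also have "\<dots> = (\<Sum>z\<in>?Z. sqrt (min (P z) (Q z)) * sqrt (max (P z) (Q z)))"
  proof (intro sum.cong refl)
    fix z
    have "(\<Prod>t<n. sqrt (p t (z t) * q t (z t))) = sqrt (P z * Q z)"
      unfolding P_def Q_def prod.distrib[symmetric] by (induction n) (simp_all add: real_sqrt_mult)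
    \<comment> \<open>Splitting into minimum and maximum before Cauchy-Schwarz brings out the sum of
      the minima, which is twice the error of the optimal test.\<close>
    also have "P z * Q z = min (P z) (Q z) * max (P z) (Q z)"
      by (cases "P z \<le> Q z") (auto simp: min_def max_def)
    finally show "(\<Prod>t<n. sqrt (p t (z t) * q t (z t))) = sqrt (min (P z) (Q z)) * sqrt (max (P z) (Q z))"
      by (simp only: real_sqrt_mult)
  qed
  finally have "(\<beta> ^ n)\<^sup>2 \<le> (\<Sum>z\<in>?Z. sqrt (min (P z) (Q z)) * sqrt (max (P z) (Q z)))\<^sup>2"
    using \<beta> by (intro power_mono) auto
  also have "\<dots> \<le> (\<Sum>z\<in>?Z. (sqrt (min (P z) (Q z)))\<^sup>2) * (\<Sum>z\<in>?Z. (sqrt (max (P z) (Q z)))\<^sup>2)"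
    by (rule Cauchy_Schwarz_ineq_sum)
  also have "\<dots> = (\<Sum>z\<in>?Z. min (P z) (Q z)) * (\<Sum>z\<in>?Z. max (P z) (Q z))"
    using nonneg by (intro arg_cong2[where f = "(*)"] sum.cong) (auto simp: le_max_iff_disj)
  finally have bc: "(\<beta>\<^sup>2) ^ n \<le> (\<Sum>z\<in>?Z. min (P z) (Q z)) * (\<Sum>z\<in>?Z. max (P z) (Q z))"
    by (simp add: power_mult[symmetric] mult.commute)
  have "(\<Sum>z\<in>?Z. min (P z) (Q z)) + (\<Sum>z\<in>?Z. max (P z) (Q z)) = (\<Sum>z\<in>?Z. P z + Q z)"
    unfolding sum.distrib[symmetric] by (intro sum.cong) (auto simp: min_def max_def)
  then have minmax: "(\<Sum>z\<in>?Z. min (P z) (Q z)) + (\<Sum>z\<in>?Z. max (P z) (Q z)) = 2"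
    using total by (simp add: sum.distrib)
  have min0: "0 \<le> (\<Sum>z\<in>?Z. min (P z) (Q z))" using nonneg by (intro sum_nonneg) auto
  \<comment> \<open>The maxima sum to at most 2, hence the minima to at least
    \<open>(\<beta>\<^sup>2) ^ n / 2\<close>.\<close>
  then have "(\<Sum>z\<in>?Z. min (P z) (Q z)) * (\<Sum>z\<in>?Z. max (P z) (Q z)) \<le> (\<Sum>z\<in>?Z. min (P z) (Q z)) * 2"
    using minmax by (intro mult_left_mono) auto
  with bc minmax have "(\<Sum>z\<in>?Z. max (P z) (Q z)) \<le> 2 - (\<beta>\<^sup>2) ^ n / 2" by linarith
  then show ?thesis by (simp only: P_def Q_def)
qed

section \<open>Reading off a sign from a reduced state\<close>

lemma rank_bij_betw:
  assumes "finite (S :: nat set)"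
  shows "bij_betw (\<lambda>i. card {j \<in> S. j < i}) S {..<card S}"
proof -
  let ?r = "\<lambda>i. card {j \<in> S. j < i}"
  have less: "?r i < ?r i'" if "i \<in> S" "i < i'" for i i'
    using that assms by (intro psubset_card_mono) auto
  then have inj: "inj_on ?r S" by (intro linorder_inj_onI') fastforce
  moreover have "?r i < card S" if "i \<in> S" for i
    using that assms by (intro psubset_card_mono) auto
  then have "?r ` S \<subseteq> {..<card S}" by auto
  then have "?r ` S = {..<card S}"
    using card_image[OF inj] by (intro card_subset_eq) auto
  ultimately show ?thesis by (simp add: bij_betw_def)
qed

text \<open>Exactly one index \<open>a\<close> is the restriction of \<open>c\<close>, and its bit
  at the position of \<open>i\<close> is the bit \<open>i\<close> of \<open>c\<close>. Writing
  indicator and sign as one product over the bits of \<open>a\<close> lets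
  \<open>sum_pow2_qubits\<close> evaluate the sum.\<close>

lemma sum_restricts_to:
  assumes S: "finite S" "i \<in> S"
  shows "(\<Sum>a<2 ^ card S. if restricts_to m S c a then (- 1) ^ qubit (card S) (card {j \<in> S. j < i}) a else 0)
    = ((- 1) ^ qubit m i c :: complex)"
proof -
  let ?r = "\<lambda>i. card {j \<in> S. j < i}"
  let ?k = "card S"
  define unrank where "unrank = the_inv_into S ?r"
  have bij: "bij_betw ?r S {..<?k}" by (rule rank_bij_betw[OF S(1)])
  have unrank: "unrank (?r j) = j" if "j \<in> S" for j
    unfolding unrank_def using bij that by (intro the_inv_into_f_f) (auto simp: bij_betw_def)
  define f where "f l b = (if b = qubit m (unrank l) c then if l = ?r i then (- 1) ^ b else 1 else 0 :: complex)" for l b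
  have ri: "?r i < ?k" using bij S(2) by (auto simp: bij_betw_def)
  have restricts: "restricts_to m S c a \<longleftrightarrow> (\<forall>l<?k. qubit ?k l a = qubit m (unrank l) c)" for a
  proof -
    have "restricts_to m S c a \<longleftrightarrow> (\<forall>j\<in>S. qubit ?k (?r j) a = qubit m (unrank (?r j)) c)"
      unfolding restricts_to_def using unrank by auto
    also have "\<dots> \<longleftrightarrow> (\<forall>l\<in>?r ` S. qubit ?k l a = qubit m (unrank l) c)" by blast
    also have "?r ` S = {..<?k}" using bij by (rule bij_betw_imp_surj_on)
    finally show ?thesis by auto
  qed
  have prod_f: "(if restricts_to m S c a then (- 1) ^ qubit ?k (?r i) a else 0) = (\<Prod>l<?k. f l (qubit ?k l a))" for a
  proof (cases "restricts_to m S c a")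
    case True
    then have "(\<Prod>l<?k. f l (qubit ?k l a)) = (\<Prod>l<?k. if l = ?r i then (- 1) ^ qubit ?k l a else 1)"
      by (intro prod.cong refl) (auto simp: f_def restricts)
    then show ?thesis using True ri by (simp add: prod.delta)
  next
    case False
    then obtain l where "l < ?k" "f l (qubit ?k l a) = 0" by (auto simp: f_def restricts)
    then have "(\<Prod>l<?k. f l (qubit ?k l a)) = 0" by (intro prod_zero) auto
    with False show ?thesis by simp
  qed
  have f_sum: "f l 0 + f l 1 = (if l = ?r i then (- 1) ^ qubit m i c else 1)" for l
  proof -
    have "qubit m (unrank l) c = 0 \<or> qubit m (unrank l) c = 1" using qubit_less[of m "unrank l" c] by linarith
    then show ?thesis using unrank[OF S(2)] by (auto simp: f_def)
  qed
  show ?thesis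
    unfolding prod_f sum_pow2_qubits f_sum using ri by (simp add: prod.delta)
qed

text \<open>Both sides are the expectation of Z on qubit \<open>i\<close>, which does not change
  when qubits outside \<open>S\<close> are traced out.\<close>

lemma sum_sign_reduced_state:
  assumes S: "S \<subseteq> {..<m}" "i \<in> S"
  shows "(\<Sum>a<2 ^ card S. (- 1) ^ qubit (card S) (card {j \<in> S. j < i}) a * reduced_state m S \<rho> $$ (a, a))
    = (\<Sum>c<2 ^ m. (- 1) ^ qubit m i c * \<rho> $$ (c, c))"
proof -
  have fin: "finite S" using S(1) finite_subset by blast
  let ?z = "\<lambda>a. (- 1) ^ qubit (card S) (card {j \<in> S. j < i}) a :: complex"
  have diag: "reduced_state m S \<rho> $$ (a, a) = (\<Sum>c<2 ^ m. if restricts_to m S c a then \<rho> $$ (c, c) else 0)"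
    if a: "a < 2 ^ card S" for a
  proof -
    have "{(c, d). c < 2 ^ m \<and> d < 2 ^ m \<and> restricts_to m S c a \<and> restricts_to m S d a \<and>
          (\<forall>i<m. i \<notin> S \<longrightarrow> qubit m i c = qubit m i d)} = (\<lambda>c. (c, c)) ` {c. c < 2 ^ m \<and> restricts_to m S c a}"
    proof safe
      \<comment> \<open>On the diagonal both indices restrict to the same \<open>a\<close>, so they
        agree inside \<open>S\<close> as well as outside.\<close>
      fix c d assume cd: "c < 2 ^ m" "d < 2 ^ m" "restricts_to m S c a" "restricts_to m S d a"
        "\<forall>i<m. i \<notin> S \<longrightarrow> qubit m i c = qubit m i d"
      then have "c = d" by (intro qubit_eqI[of c m d]) (auto simp: restricts_to_def)
      then show "(c, d) \<in> (\<lambda>c. (c, c)) ` {c. c < 2 ^ m \<and> restricts_to m S c a}" using cd by auto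
    qed
    then have "reduced_state m S \<rho> $$ (a, a) = (\<Sum>c\<in>{c. c < 2 ^ m \<and> restricts_to m S c a}. \<rho> $$ (c, c))"
      using a by (simp add: reduced_state_def sum.reindex inj_on_def)
    also have "\<dots> = (\<Sum>c<2 ^ m. if restricts_to m S c a then \<rho> $$ (c, c) else 0)"
      by (rule sum.mono_neutral_cong_left) auto
    finally show ?thesis .
  qed
  have "(\<Sum>a<2 ^ card S. ?z a * reduced_state m S \<rho> $$ (a, a)) =
      (\<Sum>a<2 ^ card S. \<Sum>c<2 ^ m. (if restricts_to m S c a then ?z a else 0) * \<rho> $$ (c, c))"
    by (intro sum.cong refl) (auto simp: diag sum_distrib_left intro!: sum.cong)
  also have "\<dots> = (\<Sum>c<2 ^ m. (\<Sum>a<2 ^ card S. if restricts_to m S c a then ?z a else 0) * \<rho> $$ (c, c))"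
    unfolding sum_distrib_right by (rule sum.swap)
  finally show ?thesis by (simp only: sum_restricts_to[OF fin S(2)])
qed

text \<open>The qubits other than \<open>i\<close> contribute their total weight 1, qubit
  \<open>i\<close> the difference of its two weights.\<close>

lemma sum_sign_biased_state:
  assumes i: "i < m"
  shows "(\<Sum>c<2 ^ m. (- 1) ^ qubit m i c * biased_state m \<delta> s $$ (c, c)) = complex_of_real (if s i then \<delta> else - \<delta>)"
proof -
  have "(\<Sum>c<2 ^ m. (- 1) ^ qubit m i c * biased_state m \<delta> s $$ (c, c)) =
    complex_of_real (\<Sum>c<2 ^ m. (- 1) ^ qubit m i c * (\<Prod>j<m. bias_weight \<delta> (s j) (qubit m j c)))"
    by (simp add: index_biased_state)
  also have "(\<Sum>c<2 ^ m. (- 1) ^ qubit m i c * (\<Prod>j<m. bias_weight \<delta> (s j) (qubit m j c))) =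
    (\<Sum>c<2 ^ m. \<Prod>j<m. (if j = i then (- 1) ^ qubit m j c else 1) * bias_weight \<delta> (s j) (qubit m j c))"
    using i by (intro sum.cong refl) (simp add: prod.distrib prod.delta)
  also have "\<dots> = (\<Prod>j<m. (if j = i then (- 1) ^ 0 else 1) * bias_weight \<delta> (s j) 0 +
      (if j = i then (- 1) ^ 1 else 1) * bias_weight \<delta> (s j) 1)"
    by (rule sum_pow2_qubits[where f = "\<lambda>j b. (if j = i then (- 1) ^ b else 1) * bias_weight \<delta> (s j) b"])
  also have "\<dots> = (\<Prod>j<m. if j = i then (if s i then \<delta> else - \<delta>) else 1)"
    by (intro prod.cong refl) (auto simp: bias_weight_def field_simps)
  also have "\<dots> = (if s i then \<delta> else - \<delta>)" using i by (simp add: prod.delta)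
  finally show ?thesis .
qed

text \<open>For any \<open>S\<close> containing \<open>i\<close>, an accurate estimate fixes the
  expectation of Z on qubit \<open>i\<close> up to \<epsilon>. The values for the two signs are 4
  \<epsilon> apart, too far for one estimate to serve both.\<close>

lemma accurate_determines_bias:
  assumes k: "1 \<le> k" "k \<le> m" and \<epsilon>: "\<epsilon> > 0"
    and acc: "accurate k m \<epsilon> (biased_state m (2 * \<epsilon>) s) est" "accurate k m \<epsilon> (biased_state m (2 * \<epsilon>) s') est"
    and i: "i < m"
  shows "s i = s' i"
proof (rule ccontr)
  assume ne: "s i \<noteq> s' i"
  have "\<exists>S. {i} \<subseteq> S \<and> S \<subseteq> {..<m} \<and> card S = k"
    using k i by (intro exists_subset_between) auto
  then obtain S where S: "S \<subseteq> {..<m}" "card S = k" "i \<in> S" by auto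
  let ?z = "\<lambda>a. (- 1) ^ qubit (card S) (card {j \<in> S. j < i}) a :: complex"
  let ?e = "\<Sum>a<2 ^ k. ?z a * est S $$ (a, a)"
  have close: "cmod (?e - complex_of_real (if s i then 2 * \<epsilon> else - (2 * \<epsilon>))) \<le> \<epsilon>"
    if "accurate k m \<epsilon> (biased_state m (2 * \<epsilon>) s) est" for s
  proof -
    let ?R = "reduced_state m S (biased_state m (2 * \<epsilon>) s)"
    have est: "est S \<in> carrier_mat (2 ^ k) (2 ^ k)" and tn: "trace_norm (est S - ?R) \<le> \<epsilon>"
      using that S by (auto simp: accurate_def)
    have R: "?R \<in> carrier_mat (2 ^ k) (2 ^ k)" using S(2) by (simp add: reduced_state_def)
    have "?e - complex_of_real (if s i then 2 * \<epsilon> else - (2 * \<epsilon>)) =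
        ?e - (\<Sum>a<2 ^ k. ?z a * ?R $$ (a, a))"
      using sum_sign_reduced_state[OF S(1,3), of "biased_state m (2 * \<epsilon>) s"] S(2)
      by (simp add: sum_sign_biased_state[OF i])
    also have "\<dots> = (\<Sum>a<2 ^ k. ?z a * (est S - ?R) $$ (a, a))"
      using est R by (simp add: sum_subtractf right_diff_distrib)
    also have "cmod \<dots> \<le> trace_norm (est S - ?R)"
      using est R by (intro diagonal_functional_le_trace_norm) (auto simp: norm_power)
    finally show ?thesis using tn by simp
  qed
  have "cmod (complex_of_real (if s i then 2 * \<epsilon> else - (2 * \<epsilon>)) - complex_of_real (if s' i then 2 * \<epsilon> else - (2 * \<epsilon>)))
      \<le> 2 * \<epsilon>"
    using norm_triangle_sub close[OF acc(1)] close[OF acc(2)]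
    by (smt (verit, ccfv_threshold) norm_diff_triangle_ineq norm_minus_commute norm_triangle_ineq4 diff_add_cancel add_diff_eq diff_diff_eq2)
  moreover have "cmod (complex_of_real (if s i then 2 * \<epsilon> else - (2 * \<epsilon>)) - complex_of_real (if s' i then 2 * \<epsilon> else - (2 * \<epsilon>)))
      = 4 * \<epsilon>"
    unfolding of_real_diff[symmetric] norm_of_real using ne \<epsilon> by auto
  ultimately show False using \<epsilon> by simp
qed

text \<open>
  Averaged over all sign patterns \<open>s\<close>, the success probability is at most that of the best guess
  of \<open>s\<close>, which factorizes over the qubits.
\<close>

lemma tomography_forces_overlap:
  assumes poss: "streaming_tomography_possible k m \<epsilon> n"
    and k: "1 \<le> k" "k \<le> m" and \<epsilon>: "0 < \<epsilon>" "2 * \<epsilon> \<le> 1"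
  shows "2 / 3 \<le> (1 - (1 - (2 * \<epsilon>)\<^sup>2) ^ n / 4) ^ m"
proof -
  obtain M D where M: "streaming_measurement n m M"
    and succ: "\<And>\<rho>. density_operator m \<rho> \<Longrightarrow> success_prob k m \<epsilon> n M D \<rho> \<ge> 2 / 3"
    using poss unfolding streaming_tomography_possible_def by blast
  define \<delta> where "\<delta> = 2 * \<epsilon>"
  have \<delta>: "\<bar>\<delta>\<bar> \<le> 1" using \<epsilon> by (simp add: \<delta>_def)
  let ?\<rho> = "biased_state m \<delta>"
  \<comment> \<open>Sign patterns are taken extensional: there are exactly 2^m of them, and
    agreement on all qubits means equality.\<close>
  let ?S = "{..<m} \<rightarrow>\<^sub>E (UNIV :: bool set)"
  define e where "e t i y s = effect_prob \<delta> (M t i ! y) s" for t i y s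
  define G where "G i z = max (\<Prod>t<n. e t i (z t) True) (\<Prod>t<n. e t i (z t) False)" for i z
  define A where "A s = {est. accurate k m \<epsilon> (?\<rho> s) est}" for s
  let ?O = "outcomes n m M"
  have povm: "qubit_povm (M t i)" if "t < n" "i < m" for t i
    using M that by (simp add: streaming_measurement_def)
  have e_nonneg: "0 \<le> e t i y s" if "t < n" "i < m" "y < length (M t i)" for t i y s
  proof -
    have "psd_mat 2 (M t i ! y)" using povm[OF that(1,2)] that(3) by (auto simp: qubit_povm_def)
    then show ?thesis unfolding e_def using \<delta> by (rule effect_prob_nonneg)
  qed
  have x_len: "x (t, i) < length (M t i)" if "x \<in> ?O" "t < n" "i < m" for x t i
    using that by (auto simp: outcomes_def PiE_iff)
  \<comment> \<open>One estimate is accurate for at most one sign pattern, so for a fixed outcome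
    even randomized processing has success probabilities of total at most 1 over all
    patterns.\<close>
  have disjoint: "(\<Sum>s\<in>?S. measure_pmf.prob (D x) (A s)) \<le> 1" for x
  proof -
    have "disjoint_family_on A ?S"
      unfolding disjoint_family_on_def
    proof (intro ballI impI)
      fix s s' assume s: "s \<in> ?S" "s' \<in> ?S" and ne: "s \<noteq> s'"
      show "A s \<inter> A s' = {}"
      proof (rule ccontr)
        assume "A s \<inter> A s' \<noteq> {}"
        then obtain est where "accurate k m \<epsilon> (?\<rho> s) est" "accurate k m \<epsilon> (?\<rho> s') est"
          unfolding A_def by auto
        then have "s i = s' i" if "i < m" for i
          using accurate_determines_bias[OF k \<epsilon>(1)] that unfolding \<delta>_def by blast
        then have "s = s'" using s by (intro PiE_ext[of s _ _ s']) auto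
        with ne show False by simp
      qed
    qed
    then have "(\<Sum>s\<in>?S. measure_pmf.prob (D x) (A s)) = measure_pmf.prob (D x) (\<Union>s\<in>?S. A s)"
      by (intro measure_pmf.finite_measure_finite_Union[symmetric] finite_PiE) auto
    then show ?thesis by simp
  qed
  have "2 / 3 * 2 ^ m = (\<Sum>s\<in>?S. 2 / 3 :: real)" by (simp add: card_PiE)
  also have "\<dots> \<le> (\<Sum>s\<in>?S. success_prob k m \<epsilon> n M D (?\<rho> s))"
    by (intro sum_mono succ density_operator_biased_state \<delta>)
  also have "\<dots> \<le> (\<Sum>s\<in>?S. \<Sum>x\<in>?O. (\<Prod>i<m. G i (\<lambda>t\<in>{..<n}. x (t, i))) * measure_pmf.prob (D x) (A s))"
    unfolding success_prob_def A_def
  proof (intro sum_mono mult_right_mono)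
    fix s x assume x: "x \<in> ?O"
    have "outcome_prob n m M (?\<rho> s) x = (\<Prod>i<m. \<Prod>t<n. e t i (x (t, i)) (s i))"
      unfolding e_def by (rule outcome_prob_biased_state[OF M x])
    \<comment> \<open>Maximizing over the sign of each qubit separately removes the dependence on
      \<open>s\<close>.\<close>
    also have "\<dots> \<le> (\<Prod>i<m. G i (\<lambda>t\<in>{..<n}. x (t, i)))"
    proof (intro prod_mono conjI)
      fix i assume "i \<in> {..<m}"
      then show "0 \<le> (\<Prod>t<n. e t i (x (t, i)) (s i))"
        using x_len[OF x] by (intro prod_nonneg) (auto intro!: e_nonneg)
      show "(\<Prod>t<n. e t i (x (t, i)) (s i)) \<le> G i (\<lambda>t\<in>{..<n}. x (t, i))"
        by (cases "s i") (auto simp: G_def)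
    qed
    finally show "outcome_prob n m M (?\<rho> s) x \<le> (\<Prod>i<m. G i (\<lambda>t\<in>{..<n}. x (t, i)))" .
  qed auto
  also have "\<dots> = (\<Sum>x\<in>?O. (\<Prod>i<m. G i (\<lambda>t\<in>{..<n}. x (t, i))) * (\<Sum>s\<in>?S. measure_pmf.prob (D x) (A s)))"
    unfolding sum_distrib_left by (rule sum.swap)
  also have "\<dots> \<le> (\<Sum>x\<in>?O. (\<Prod>i<m. G i (\<lambda>t\<in>{..<n}. x (t, i))) * 1)"
  proof (intro sum_mono mult_left_mono disjoint prod_nonneg ballI)
    fix x i assume x: "x \<in> ?O" and i: "i \<in> {..<m}"
    then have "0 \<le> (\<Prod>t<n. e t i (x (t, i)) True)"
      using x_len[OF x] by (intro prod_nonneg) (auto intro!: e_nonneg)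
    then show "0 \<le> G i (\<lambda>t\<in>{..<n}. x (t, i))" by (simp add: G_def le_max_iff_disj)
  qed
  also have "\<dots> = (\<Prod>i<m. \<Sum>z\<in>(\<Pi>\<^sub>E t\<in>{..<n}. {..<length (M t i)}). G i z)"
    unfolding outcomes_def mult_1_right by (rule sum_PiE_prod_qubits) auto
  also have "\<dots> \<le> (\<Prod>i<m. 2 - (1 - \<delta>\<^sup>2) ^ n / 2)"
  proof (intro prod_mono conjI)
    fix i assume "i \<in> {..<m}"
    then have i: "i < m" by simp
    show "0 \<le> (\<Sum>z\<in>(\<Pi>\<^sub>E t\<in>{..<n}. {..<length (M t i)}). G i z)"
    proof (rule sum_nonneg)
      fix z assume "z \<in> (\<Pi>\<^sub>E t\<in>{..<n}. {..<length (M t i)})"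
      then have "0 \<le> (\<Prod>t<n. e t i (z t) True)"
        using i by (intro prod_nonneg) (auto intro!: e_nonneg)
      then show "0 \<le> G i z" by (simp add: G_def le_max_iff_disj)
    qed
    have d: "0 \<le> 1 - \<delta>\<^sup>2" using \<delta> by (simp add: abs_square_le_1)
    have "(\<Sum>z\<in>(\<Pi>\<^sub>E t\<in>{..<n}. {..<length (M t i)}). G i z) \<le> 2 - ((sqrt (1 - \<delta>\<^sup>2))\<^sup>2) ^ n / 2"
      unfolding G_def
    proof (rule sum_max_prod_le)
      fix t assume t: "t < n"
      show "sqrt (1 - \<delta>\<^sup>2) \<le> (\<Sum>y<length (M t i). sqrt (e t i y True * e t i y False))"
        unfolding e_def by (rule sum_sqrt_effect_prob[OF povm[OF t i] \<delta>])
      show "(\<Sum>y<length (M t i). e t i y True) = 1" "(\<Sum>y<length (M t i). e t i y False) = 1"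
        unfolding e_def by (rule sum_effect_prob[OF povm[OF t i]])+
    qed (use i d e_nonneg in auto)
    then show "(\<Sum>z\<in>(\<Pi>\<^sub>E t\<in>{..<n}. {..<length (M t i)}). G i z) \<le> 2 - (1 - \<delta>\<^sup>2) ^ n / 2"
      using d by simp
  qed
  also have "\<dots> = (2 * (1 - (1 - \<delta>\<^sup>2) ^ n / 4)) ^ m" by simp
  also have "\<dots> = (1 - (1 - \<delta>\<^sup>2) ^ n / 4) ^ m * 2 ^ m" by (simp only: power_mult_distrib mult.commute)
  finally show ?thesis by (simp add: \<delta>_def)
qed

text \<open>With x = 4 \<epsilon>^2 and u = (1 - x)^n the overlap bound gives 2/3 \<le> exp (- m u /
  4), so m u \<le> 2 and ln m - ln 2 \<le> 2 n x = 8 n \<epsilon>^2. The constant is 32 = 8 * 2 * 2: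
  one factor 2 from ln m - ln 2 \<ge> ln m / 2 for m \<ge> 4, the other from passing to the binary
  logarithm.\<close>

lemma streaming_tomography_lower:
  assumes poss: "streaming_tomography_possible k m \<epsilon> n"
    and k: "1 \<le> k" "k \<le> m" and m: "4 \<le> m" and \<epsilon>: "0 < \<epsilon>" "\<epsilon> \<le> 1 / 4"
  shows "1 / 32 * (log 2 (real m) / \<epsilon>\<^sup>2) \<le> real n"
proof -
  define x where "x = (2 * \<epsilon>)\<^sup>2"
  have x: "0 < x" "x \<le> 1 / 4"
  proof -
    show "0 < x" using \<epsilon> by (simp add: x_def)
    have "x \<le> (2 * (1 / 4))\<^sup>2" unfolding x_def using \<epsilon> by (intro power_mono) auto
    then show "x \<le> 1 / 4" by (simp add: power2_eq_square)
  qed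
  define u where "u = (1 - x) ^ n"
  have u: "0 < u" "u \<le> 1" unfolding u_def using x by (auto intro!: power_le_one)
  have "2 / 3 \<le> (1 - u / 4) ^ m"
    using tomography_forces_overlap[OF poss k \<epsilon>(1)] \<epsilon>(2) by (simp add: u_def x_def)
  also have "\<dots> \<le> exp (- (u / 4)) ^ m"
    using u exp_ge_add_one_self[of "- (u / 4)"] by (intro power_mono) auto
  also have "\<dots> = exp (- (m * u / 4))" by (simp add: exp_of_nat_mult[symmetric])
  finally have "ln (2 / 3) \<le> ln (exp (- (m * u / 4)))" by (subst ln_le_cancel_iff) auto
  then have "ln (2 / 3) \<le> - (m * u / 4)" by simp
  moreover have "- ln (2 / 3 :: real) \<le> 1 / 2"
    using ln_le_minus_one[of "3 / 2 :: real"] by (simp add: ln_div)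
  ultimately have "m * u \<le> 2" by linarith
  then have "u \<le> 2 / m" using m by (simp add: field_simps)
  then have "ln u \<le> ln (2 / m)" using u m by simp
  then have "ln m - ln 2 \<le> - (n * ln (1 - x))"
    using x m by (simp add: u_def ln_realpow ln_div)
  also have "\<dots> \<le> n * (2 * x)"
  proof -
    \<comment> \<open>As x \<le> 1/4, the quadratic term is at most x / 2.\<close>
    have "- x - 2 * x\<^sup>2 \<le> ln (1 - x)" using x by (intro ln_one_minus_pos_lower_bound) auto
    moreover have "x\<^sup>2 \<le> x * (1 / 4)" unfolding power2_eq_square using x by (intro mult_left_mono) auto
    ultimately have "- ln (1 - x) \<le> 2 * x" using x by linarith
    then have "n * (- ln (1 - x)) \<le> n * (2 * x)" by (intro mult_left_mono) auto
    then show ?thesis by simp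
  qed
  finally have main: "ln m - ln 2 \<le> 8 * n * \<epsilon>\<^sup>2" by (simp add: x_def power_mult_distrib)
  have "2 * ln 2 = ln (4 :: real)" using ln_realpow[of 2 2] by simp
  also have "\<dots> \<le> ln m" using m by simp
  finally have "ln m / 2 \<le> 8 * n * \<epsilon>\<^sup>2" using main by linarith
  moreover have "log 2 (real m) / 2 \<le> ln m"
  proof -
    have "1 / 2 \<le> ln (2 :: real)" using ln2_ge_two_thirds by simp
    then have "ln m * (1 / 2) \<le> ln m * ln 2" using m by (intro mult_left_mono) auto
    then show ?thesis by (simp add: log_def field_simps)
  qed
  ultimately have "log 2 (real m) \<le> 32 * n * \<epsilon>\<^sup>2" by linarith
  then show ?thesis using \<epsilon> by (simp add: field_simps)
qed

text \<open>If no number of copies suffices, the complexity is infinite and the bound is trivial;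
  otherwise the infimum is attained, and the bound for feasible \<open>n\<close> applies to
  it.\<close>

lemma sample_complexity_lower:
  assumes k: "1 \<le> k" "k \<le> m" and m: "4 \<le> m" and \<epsilon>: "0 < \<epsilon>" "\<epsilon> \<le> 1 / 4"
  shows "ereal (1 / 32 * (log 2 (real m) / \<epsilon>\<^sup>2)) \<le> ereal_of_enat (sample_complexity k m \<epsilon>)"
proof (cases "sample_complexity k m \<epsilon>")
  case (enat n)
  let ?A = "{n. streaming_tomography_possible k m \<epsilon> n}"
  have "?A \<noteq> {}"
  proof
    assume "?A = {}"
    then show False using enat by (simp add: sample_complexity_def Inf_enat_def)
  qed
  then have "sample_complexity k m \<epsilon> \<in> enat ` ?A"
    unfolding sample_complexity_def by (auto intro: wellorder_InfI)
  then have "streaming_tomography_possible k m \<epsilon> n" using enat by auto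
  then show ?thesis using streaming_tomography_lower[OF _ k m \<epsilon>] enat by simp
qed simp

theorem theorem1p2p4:
  shows "(\<exists>C::real. C > 0 \<and> (\<forall>(k::nat) (m::nat) (\<epsilon>::real). 1 \<le> k \<and> k \<le> m \<and> 0 < \<epsilon> \<and> \<epsilon> \<le> 1 \<longrightarrow>
            ereal_of_enat (sample_complexity k m \<epsilon>)
              \<le> ereal (C * (108 ^ k * (log 2 (real (m choose k)) + real k * log 2 6) / \<epsilon>\<^sup>2))))
       \<and> (\<forall>k::nat. 1 \<le> k \<longrightarrow>
            (\<exists>(c::real) (C::real) (m\<^sub>0::nat) (\<epsilon>\<^sub>0::real). c > 0 \<and> C > 0 \<and> \<epsilon>\<^sub>0 > 0 \<and>
              (\<forall>(m::nat) (\<epsilon>::real). k \<le> m \<and> m\<^sub>0 \<le> m \<and> 0 < \<epsilon> \<and> \<epsilon> \<le> \<epsilon>\<^sub>0 \<and> \<epsilon> \<le> 1 \<longrightarrow>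
                 ereal (c * (log 2 (real m) / \<epsilon>\<^sup>2)) \<le> ereal_of_enat (sample_complexity k m \<epsilon>) \<and>
                 ereal_of_enat (sample_complexity k m \<epsilon>) \<le> ereal (C * (log 2 (real m) / \<epsilon>\<^sup>2)))))"
proof (intro conjI allI impI)
  show "\<exists>C::real. C > 0 \<and> (\<forall>(k::nat) (m::nat) (\<epsilon>::real). 1 \<le> k \<and> k \<le> m \<and> 0 < \<epsilon> \<and> \<epsilon> \<le> 1 \<longrightarrow>
            ereal_of_enat (sample_complexity k m \<epsilon>)
              \<le> ereal (C * (108 ^ k * (log 2 (real (m choose k)) + real k * log 2 6) / \<epsilon>\<^sup>2)))"
    by (intro exI[of _ 97] conjI allI impI sample_complexity_upper) auto
next
  fix k :: nat assume k: "1 \<le> k"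
  \<comment> \<open>For fixed \<open>k\<close> the power of 108 is a constant. The 4 * k comes from
    log (m choose k) \<le> k log m and log 6 \<le> 3 \<le> 3 log m.\<close>
  define C where "C = 97 * 108 ^ k * (4 * real k)"
  have "ereal_of_enat (sample_complexity k m \<epsilon>) \<le> ereal (C * (log 2 (real m) / \<epsilon>\<^sup>2))"
    if m: "k \<le> m" "4 \<le> m" and \<epsilon>: "0 < \<epsilon>" "\<epsilon> \<le> 1" for m \<epsilon>
  proof -
    have "real (m choose k) \<le> real (m ^ k)" using m by (simp add: binomial_le_pow del: of_nat_power)
    moreover have C: "0 < real (m choose k)" using m by simp
    ultimately have "log 2 (real (m choose k)) \<le> log 2 (real (m ^ k))" by (subst log_le_cancel_iff) auto
    also have "\<dots> = k * log 2 m" using m by (simp add: log_nat_power)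
    finally have 1: "log 2 (real (m choose k)) \<le> k * log 2 m" .
    have "log 2 (6 :: real) \<le> log 2 (2 ^ 3)" by (subst log_le_cancel_iff) auto
    then have "log 2 (6 :: real) \<le> 3" by (simp only: log_pow_cancel)
    moreover have "log 2 2 \<le> log 2 (real m)" using m by (subst log_le_cancel_iff) auto
    ultimately have "log 2 6 \<le> 3 * log 2 (real m)" by simp
    then have "real k * log 2 6 \<le> real k * (3 * log 2 (real m))" by (intro mult_left_mono) auto
    with 1 have L: "log 2 (real (m choose k)) + real k * log 2 6 \<le> 4 * real k * log 2 m" by simp
    have "ereal_of_enat (sample_complexity k m \<epsilon>)
        \<le> ereal (97 * (108 ^ k * (log 2 (real (m choose k)) + real k * log 2 6) / \<epsilon>\<^sup>2))"
      using k m \<epsilon> by (intro sample_complexity_upper) auto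
    also have "97 * (108 ^ k * (log 2 (real (m choose k)) + real k * log 2 6) / \<epsilon>\<^sup>2)
        \<le> 97 * (108 ^ k * (4 * real k * log 2 m) / \<epsilon>\<^sup>2)"
      using L by (intro mult_left_mono divide_right_mono) auto
    also have "\<dots> = C * (log 2 (real m) / \<epsilon>\<^sup>2)" by (simp add: C_def)
    finally show ?thesis by simp
  qed
  moreover have "C > 0" using k by (simp add: C_def)
  ultimately have "0 < (1 / 32 :: real) \<and> 0 < C \<and> 0 < (1 / 4 :: real) \<and>
      (\<forall>m \<epsilon>. k \<le> m \<and> 4 \<le> m \<and> 0 < \<epsilon> \<and> \<epsilon> \<le> 1 / 4 \<and> \<epsilon> \<le> 1 \<longrightarrow>
         ereal (1 / 32 * (log 2 (real m) / \<epsilon>\<^sup>2)) \<le> ereal_of_enat (sample_complexity k m \<epsilon>) \<and>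
         ereal_of_enat (sample_complexity k m \<epsilon>) \<le> ereal (C * (log 2 (real m) / \<epsilon>\<^sup>2)))"
    using sample_complexity_lower[OF k] by (intro conjI allI impI) auto
  then show "\<exists>(c::real) (C::real) (m\<^sub>0::nat) (\<epsilon>\<^sub>0::real). c > 0 \<and> C > 0 \<and> \<epsilon>\<^sub>0 > 0 \<and>
      (\<forall>(m::nat) (\<epsilon>::real). k \<le> m \<and> m\<^sub>0 \<le> m \<and> 0 < \<epsilon> \<and> \<epsilon> \<le> \<epsilon>\<^sub>0 \<and> \<epsilon> \<le> 1 \<longrightarrow>
         ereal (c * (log 2 (real m) / \<epsilon>\<^sup>2)) \<le> ereal_of_enat (sample_complexity k m \<epsilon>) \<and>
         ereal_of_enat (sample_complexity k m \<epsilon>) \<le> ereal (C * (log 2 (real m) / \<epsilon>\<^sup>2)))"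
    by blast
qed

end
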